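(* Let $H(x,y,z)=y$ on $\mathbb{R}^3$. For $\epsilon>0$ let $u=u_\epsilon$ be the solution of the two-ball insulated conductivity problem (described in the context) for this $H$. Then there is a constant $C>0$ independent of $\epsilon$ such that $$|\nabla u(x,0,0)|\ge C\,\frac{1}{\epsilon^{\frac{2-\sqrt2}{2}}}\qquad\text{for all } |x|<\frac{\epsilon}{2}$$ and all sufficiently small $\epsilon>0$.
   Context: For $\epsilon>0$, $B_1$ and $B_2$ denote the open unit balls in $\mathbb{R}^3$ centered at $(-1-\frac{\epsilon}{2},0,0)$ and $(1+\frac{\epsilon}{2},0,0)$ respectively, so that $\mathrm{dist}(B_1,B_2)=\epsilon$. Given a harmonic function $H$ on $\mathbb{R}^3$, the solution $u$ of the insulated conductivity problem is the function satisfying $\Delta u=0$ in $\mathbb{R}^3\setminus\overline{B_1\cup B_2}$, $\partial_\nu u=0$ on $\partial(B_1\cup B_2)$ ($\nu$ the unit normal), and $u(\mathbf{x})-H(\mathbf{x})=O(|\mathbf{x}|^{-2})$ as $|\mathbf{x}|\to\infty$. Points are written $\mathbf{x}=(x,y,z)$. "For all sufficiently small $\epsilon$" means for all $0<\epsilon<\epsilon_0$ for some $\epsilon_0>0$. *)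

theory Defs
  imports "HOL-Analysis.Analysis" "HOL-Library.Landau_Symbols"
begin

definition grad :: "('a::euclidean_space \<Rightarrow> real) \<Rightarrow> 'a \<Rightarrow> 'a" where
  "grad f x = (\<Sum>b\<in>Basis. frechet_derivative f (at x) b *\<^sub>R b)"

definition laplacian :: "('a::euclidean_space \<Rightarrow> real) \<Rightarrow> 'a \<Rightarrow> real" where
  "laplacian f x = (\<Sum>b\<in>Basis. frechet_derivative (grad f) (at x) b \<bullet> b)"

text \<open>Twice continuously differentiable; only meant for open \<open>S\<close>.\<close>

definition C2_on :: "'a::euclidean_space set \<Rightarrow> ('a \<Rightarrow> real) \<Rightarrow> bool" where
  "C2_on S f \<longleftrightarrow>
     (\<forall>x\<in>S. f differentiable (at x)) \<and>
     (\<forall>x\<in>S. grad f differentiable (at x)) \<and>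
     (\<forall>b\<in>Basis. continuous_on S (\<lambda>x. frechet_derivative (grad f) (at x) b))"

definition harmonic_on :: "'a::euclidean_space set \<Rightarrow> ('a \<Rightarrow> real) \<Rightarrow> bool" where
  "harmonic_on S f \<longleftrightarrow> open S \<and> C2_on S f \<and> (\<forall>x\<in>S. laplacian f x = 0)"

definition center1 :: "real \<Rightarrow> real^3" where
  "center1 \<epsilon> = vector [- 1 - \<epsilon> / 2, 0, 0]"

definition center2 :: "real \<Rightarrow> real^3" where
  "center2 \<epsilon> = vector [1 + \<epsilon> / 2, 0, 0]"

definition exterior :: "real \<Rightarrow> (real^3) set" where
  "exterior \<epsilon> = - closure (ball (center1 \<epsilon>) 1 \<union> ball (center2 \<epsilon>) 1)"

text \<open>
  Classical solutions: \<open>u\<close> is of class C2 in the exterior domain and of class C1 up to its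
  boundary, with \<open>G\<close> the gradient of \<open>u\<close> on the closed exterior domain (one-sided at boundary
  points), so that the Neumann condition can be read pointwise. The unit normal at a point \<open>p\<close>
  of the unit sphere about \<open>c\<close> is \<open>p - c\<close>; for \<open>\<epsilon> > 0\<close> the two spheres are disjoint and make up
  the boundary. The values of \<open>u\<close> inside the balls play no role.
\<close>

definition insulated_solution :: "real \<Rightarrow> (real^3 \<Rightarrow> real) \<Rightarrow> (real^3 \<Rightarrow> real) \<Rightarrow> bool" where
  "insulated_solution \<epsilon> H u \<longleftrightarrow>
     harmonic_on (exterior \<epsilon>) u \<and>
     (\<exists>G. continuous_on (closure (exterior \<epsilon>)) G \<and>
          (\<forall>p\<in>closure (exterior \<epsilon>).
             (u has_derivative (\<lambda>h. G p \<bullet> h)) (at p within closure (exterior \<epsilon>))) \<and>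
          (\<forall>c\<in>{center1 \<epsilon>, center2 \<epsilon>}. \<forall>p\<in>sphere c 1. G p \<bullet> (p - c) = 0)) \<and>
     (\<lambda>p. u p - H p) \<in> O[at_infinity](\<lambda>p. 1 / norm p ^ 2)"

end

theory Submission
  imports Defs
begin

text \<open>
  The proof is a comparison argument; write \<open>p = (x, y, z)\<close> and \<open>t = y\<^sup>2 + z\<^sup>2\<close>. Let \<open>U\<close> be the part
  of \<open>u\<close> that is odd in \<open>y\<close>; it vanishes on \<open>y = 0\<close> and has the same \<open>y\<close>-derivative as \<open>u\<close> on the
  axis. If \<open>w\<close> has positive Laplacian and positive normal derivative on the spheres, then
  \<open>w - k U\<close> has no local maximum, for any constant \<open>k\<close>.

  First, the normal derivative of \<open>y\<close> on either sphere is \<open>y\<close> itself, so \<open>U \<ge> y\<close> for \<open>y \<ge> 0\<close>. In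
  the neck \<open>t \<le> 1/8\<close> between the balls this is improved to a lower bound for \<open>100 U\<close> by the barrier
  \<open>y (\<tau>\<^sup>\<mu> (1 + x\<^sup>2 (\<alpha>/\<tau> + \<beta> \<epsilon>/\<tau>\<^sup>2 + 20)) + 30)\<close> with \<open>\<tau> = t + 2 \<epsilon>\<close>. Averaging over the gap, whose
  width is about \<open>\<epsilon> + t\<close>, reduces \<open>y G(t)\<close> to the condition
  \<open>(\<epsilon> + t) (4 G' + 2 t G'') + G + 2 t G' \<ge> 0\<close>; for \<open>\<epsilon> = 0\<close> the power \<open>G = t\<^sup>\<mu>\<close> is a solution
  exactly when \<open>2 \<mu>\<^sup>2 + 4 \<mu> + 1 = 0\<close>, whose larger root is \<open>\<mu> = - (2 - sqrt 2) / 2\<close>. The shift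
  \<open>2 \<epsilon>\<close> makes the condition hold up to \<open>t = 0\<close>, and the constants \<open>20\<close> and \<open>30\<close> absorb the
  lower-order errors in the interior and on the spheres. On the axis the barrier has slope of
  order \<open>\<epsilon>\<^sup>\<mu>\<close>.
\<close>

section \<open>Gradient and Laplacian at a point\<close>

text \<open>
  On the real line \<open>has_gradient_laplacian f a b s\<close> says that \<open>a\<close> and \<open>b\<close> are the first and the
  second derivative of \<open>f\<close> at \<open>s\<close>.
\<close>

definition has_gradient_laplacian ::
    "('a::euclidean_space \<Rightarrow> real) \<Rightarrow> 'a \<Rightarrow> real \<Rightarrow> 'a \<Rightarrow> bool" where
  "has_gradient_laplacian f g L p \<longleftrightarrow>
     (\<exists>G G'. (\<forall>\<^sub>F q in nhds p. GDERIV f q :> G q) \<and> G p = g \<and>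
             (G has_derivative G') (at p) \<and> L = (\<Sum>b\<in>Basis. G' b \<bullet> b))"

lemma has_gradient_laplacianI:
  assumes "\<forall>\<^sub>F q in nhds p. GDERIV f q :> G q" "(G has_derivative G') (at p)"
    and "g = G p" "L = (\<Sum>b\<in>Basis. G' b \<bullet> b)"
  shows "has_gradient_laplacian f g L p"
  using assms unfolding has_gradient_laplacian_def by blast

lemma has_gradient_laplacianE:
  assumes "has_gradient_laplacian f g L p"
  obtains G G' where "\<forall>\<^sub>F q in nhds p. GDERIV f q :> G q" "(G has_derivative G') (at p)"
    "g = G p" "L = (\<Sum>b\<in>Basis. G' b \<bullet> b)"
  using assms unfolding has_gradient_laplacian_def by blast

lemma has_gradient_laplacian_eq_rhs:
  assumes "has_gradient_laplacian f g L p" "g = g'" "L = L'"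
  shows "has_gradient_laplacian f g' L' p"
  using assms by simp

lemma has_gradient_laplacian_GDERIV:
  assumes "has_gradient_laplacian f g L p"
  shows "GDERIV f p :> g"
  using assms by (auto elim!: has_gradient_laplacianE dest: eventually_nhds_x_imp_x)

lemma has_gradient_laplacian_const: "has_gradient_laplacian (\<lambda>q. k) 0 0 p"
  by (rule has_gradient_laplacianI[where G = "\<lambda>q. 0" and G' = "\<lambda>h. 0"])
    (simp_all add: GDERIV_const)

lemma has_gradient_laplacian_inner: "has_gradient_laplacian (\<lambda>q. q \<bullet> a) a 0 p"
  by (rule has_gradient_laplacianI[where G = "\<lambda>q. a" and G' = "\<lambda>h. 0"])
    (auto simp: gderiv_def intro!: always_eventually derivative_eq_intros)

lemma has_gradient_laplacian_add:
  assumes "has_gradient_laplacian f g L p" "has_gradient_laplacian f' g' L' p"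
  shows "has_gradient_laplacian (\<lambda>q. f q + f' q) (g + g') (L + L') p"
proof -
  obtain G D where G: "\<forall>\<^sub>F q in nhds p. GDERIV f q :> G q" "(G has_derivative D) (at p)"
    "g = G p" "L = (\<Sum>b\<in>Basis. D b \<bullet> b)"
    by (rule has_gradient_laplacianE[OF assms(1)])
  obtain G' D' where G': "\<forall>\<^sub>F q in nhds p. GDERIV f' q :> G' q" "(G' has_derivative D') (at p)"
    "g' = G' p" "L' = (\<Sum>b\<in>Basis. D' b \<bullet> b)"
    by (rule has_gradient_laplacianE[OF assms(2)])
  show ?thesis
  proof (rule has_gradient_laplacianI)
    show "\<forall>\<^sub>F q in nhds p. GDERIV (\<lambda>q. f q + f' q) q :> G q + G' q"
      using G(1) G'(1) by eventually_elim (rule GDERIV_add)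
    show "((\<lambda>q. G q + G' q) has_derivative (\<lambda>h. D h + D' h)) (at p)"
      using G(2) G'(2) by (rule has_derivative_add)
  qed (simp_all add: G G' inner_add_left sum.distrib)
qed

lemma has_gradient_laplacian_mult:
  assumes "has_gradient_laplacian f g L p" "has_gradient_laplacian f' g' L' p"
  shows "has_gradient_laplacian (\<lambda>q. f q * f' q) (f p *\<^sub>R g' + f' p *\<^sub>R g)
    (f p * L' + 2 * (g \<bullet> g') + f' p * L) p"
proof -
  obtain G D where G: "\<forall>\<^sub>F q in nhds p. GDERIV f q :> G q" "(G has_derivative D) (at p)"
    "g = G p" "L = (\<Sum>b\<in>Basis. D b \<bullet> b)"
    by (rule has_gradient_laplacianE[OF assms(1)])
  obtain G' D' where G': "\<forall>\<^sub>F q in nhds p. GDERIV f' q :> G' q" "(G' has_derivative D') (at p)"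
    "g' = G' p" "L' = (\<Sum>b\<in>Basis. D' b \<bullet> b)"
    by (rule has_gradient_laplacianE[OF assms(2)])
  have df: "(f has_derivative (\<lambda>h. h \<bullet> g)) (at p)" "(f' has_derivative (\<lambda>h. h \<bullet> g')) (at p)"
    using assms[THEN has_gradient_laplacian_GDERIV] by (simp_all add: gderiv_def)
  show ?thesis
  proof (rule has_gradient_laplacianI)
    show "\<forall>\<^sub>F q in nhds p. GDERIV (\<lambda>q. f q * f' q) q :> f q *\<^sub>R G' q + f' q *\<^sub>R G q"
      using G(1) G'(1) by eventually_elim (rule GDERIV_mult)
    show "((\<lambda>q. f q *\<^sub>R G' q + f' q *\<^sub>R G q) has_derivative
        (\<lambda>h. f p *\<^sub>R D' h + (h \<bullet> g) *\<^sub>R G' p + (f' p *\<^sub>R D h + (h \<bullet> g') *\<^sub>R G p))) (at p)"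
      by (intro has_derivative_add has_derivative_scaleR df G(2) G'(2))
    have "(\<Sum>b\<in>Basis. (b \<bullet> g) * (g' \<bullet> b)) = g \<bullet> g'"
      by (simp add: euclidean_inner[of g g'] inner_commute)
    moreover have "(\<Sum>b\<in>Basis. (b \<bullet> g') * (g \<bullet> b)) = g \<bullet> g'"
      by (simp add: euclidean_inner[of g g'] inner_commute mult.commute)
    ultimately show "f p * L' + 2 * (g \<bullet> g') + f' p * L =
        (\<Sum>b\<in>Basis. (f p *\<^sub>R D' b + (b \<bullet> g) *\<^sub>R G' p + (f' p *\<^sub>R D b + (b \<bullet> g') *\<^sub>R G p)) \<bullet> b)"
      using G(3,4) G'(3,4) by (simp add: inner_add_left sum.distrib sum_distrib_left)
  qed (simp add: G G')
qed

lemma has_gradient_laplacian_cmult: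
  assumes "has_gradient_laplacian f g L p"
  shows "has_gradient_laplacian (\<lambda>q. k * f q) (k *\<^sub>R g) (k * L) p"
  using has_gradient_laplacian_mult[OF has_gradient_laplacian_const assms, of k] by simp

lemma has_gradient_laplacian_diff:
  assumes "has_gradient_laplacian f g L p" "has_gradient_laplacian f' g' L' p"
  shows "has_gradient_laplacian (\<lambda>q. f q - f' q) (g - g') (L - L') p"
  using has_gradient_laplacian_add[OF assms(1) has_gradient_laplacian_cmult[OF assms(2), of "-1"]]
  by simp

lemma has_gradient_laplacian_compose_real:
  fixes \<phi> :: "real \<Rightarrow> real"
  assumes "has_gradient_laplacian \<phi> a b (f p)" "has_gradient_laplacian f g L p"
  shows "has_gradient_laplacian (\<lambda>q. \<phi> (f q)) (a *\<^sub>R g) (b * (g \<bullet> g) + a * L) p"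
proof -
  obtain \<phi>' D where \<phi>': "\<forall>\<^sub>F s in nhds (f p). DERIV \<phi> s :> \<phi>' s" "(\<phi>' has_derivative D) (at (f p))"
    "a = \<phi>' (f p)" "b = D 1"
    using assms(1) by (auto elim!: has_gradient_laplacianE)
  obtain G G' where G: "\<forall>\<^sub>F q in nhds p. GDERIV f q :> G q" "(G has_derivative G') (at p)"
    "g = G p" "L = (\<Sum>b\<in>Basis. G' b \<bullet> b)"
    by (rule has_gradient_laplacianE[OF assms(2)])
  have df: "(f has_derivative (\<lambda>h. h \<bullet> g)) (at p)"
    using has_gradient_laplacian_GDERIV[OF assms(2)] by (simp add: gderiv_def)
  have "D h = b * h" for h
    using linear_scale[OF has_derivative_linear[OF \<phi>'(2)], of h 1] by (simp add: \<phi>'(4) mult.commute)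
  then have d\<phi>': "((\<lambda>q. \<phi>' (f q)) has_derivative (\<lambda>h. b * (h \<bullet> g))) (at p)"
    using has_derivative_compose[OF df \<phi>'(2)] by simp
  show ?thesis
  proof (rule has_gradient_laplacianI)
    have "(f \<longlongrightarrow> f p) (nhds p)"
      using has_derivative_continuous[OF df]
      by (simp add: continuous_at tendsto_at_iff_tendsto_nhds)
    with \<phi>'(1) have "\<forall>\<^sub>F q in nhds p. DERIV \<phi> (f q) :> \<phi>' (f q)"
      by (rule eventually_compose_filterlim)
    with G(1) show "\<forall>\<^sub>F q in nhds p. GDERIV (\<lambda>q. \<phi> (f q)) q :> \<phi>' (f q) *\<^sub>R G q"
      by eventually_elim (rule GDERIV_DERIV_compose)
    show "((\<lambda>q. \<phi>' (f q) *\<^sub>R G q) has_derivative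
        (\<lambda>h. \<phi>' (f p) *\<^sub>R G' h + (b * (h \<bullet> g)) *\<^sub>R G p)) (at p)"
      by (rule has_derivative_scaleR[OF d\<phi>' G(2)])
    have "(\<Sum>e\<in>Basis. (e \<bullet> g) * (g \<bullet> e)) = g \<bullet> g"
      by (simp add: euclidean_inner[of g g] inner_commute)
    then show "b * (g \<bullet> g) + a * L =
        (\<Sum>e\<in>Basis. (\<phi>' (f p) *\<^sub>R G' e + (b * (e \<bullet> g)) *\<^sub>R G p) \<bullet> e)"
      by (simp add: G(3,4) \<phi>'(3) inner_add_left sum.distrib sum_distrib_left[symmetric] mult.assoc)
  qed (simp add: G \<phi>')
qed

lemma trace_orthogonal_transformation:
  fixes D R :: "'a::euclidean_space \<Rightarrow> 'a"
  assumes "linear D" "orthogonal_transformation R"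
  shows "(\<Sum>b\<in>Basis. D (R b) \<bullet> R b) = (\<Sum>b\<in>Basis. D b \<bullet> b)"
proof -
  have R: "linear R" "\<And>v w. R v \<bullet> R w = v \<bullet> w" "surj R"
    using assms(2) orthogonal_transformation_surj[OF assms(2)]
    by (simp_all add: orthogonal_transformation_def)
  have expand: "(\<Sum>b\<in>Basis. (R b \<bullet> v) *\<^sub>R R b) = v" for v
  proof -
    obtain w where w: "v = R w" using R(3) by blast
    have "(\<Sum>b\<in>Basis. (R b \<bullet> v) *\<^sub>R R b) = R (\<Sum>b\<in>Basis. (w \<bullet> b) *\<^sub>R b)"
      by (simp add: w R(2) linear_sum[OF R(1)] linear_scale[OF R(1)] inner_commute)
    then show ?thesis by (simp add: w euclidean_representation)
  qed
  have "D (R b) = (\<Sum>c\<in>Basis. (R b \<bullet> c) *\<^sub>R D c)" for b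
    by (subst euclidean_representation[of "R b", symmetric])
      (simp add: linear_sum[OF assms(1)] linear_scale[OF assms(1)])
  then have "(\<Sum>b\<in>Basis. D (R b) \<bullet> R b) = (\<Sum>b\<in>Basis. \<Sum>c\<in>Basis. (R b \<bullet> c) * (D c \<bullet> R b))"
    by (simp add: inner_sum_left)
  also have "\<dots> = (\<Sum>c\<in>Basis. D c \<bullet> (\<Sum>b\<in>Basis. (R b \<bullet> c) *\<^sub>R R b))"
    by (subst sum.swap) (simp add: inner_sum_right)
  finally show ?thesis by (simp add: expand)
qed

lemma has_gradient_laplacian_compose_orthogonal:
  fixes R :: "'a::euclidean_space \<Rightarrow> 'a"
  assumes "has_gradient_laplacian f g L (R p)" "orthogonal_transformation R"
  shows "has_gradient_laplacian (\<lambda>q. f (R q)) (inv R g) L p"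
proof -
  obtain G D where G: "\<forall>\<^sub>F q in nhds (R p). GDERIV f q :> G q" "(G has_derivative D) (at (R p))"
    "g = G (R p)" "L = (\<Sum>b\<in>Basis. D b \<bullet> b)"
    by (rule has_gradient_laplacianE[OF assms(1)])
  have R: "bounded_linear R" "bounded_linear (inv R)"
    using assms(2) orthogonal_transformation_inv[OF assms(2)]
    by (simp_all add: orthogonal_transformation_linear linear_conv_bounded_linear[symmetric])
  have inner_inv: "v \<bullet> inv R w = R v \<bullet> w" for v w
    using assms(2) surj_f_inv_f[OF orthogonal_transformation_surj[OF assms(2)], of w]
    by (metis orthogonal_transformation_def)
  show ?thesis
  proof (rule has_gradient_laplacianI)
    have "(R \<longlongrightarrow> R p) (nhds p)"
      using linear_continuous_at[OF R(1)] by (simp add: continuous_at tendsto_at_iff_tendsto_nhds)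
    with G(1) have "\<forall>\<^sub>F q in nhds p. GDERIV f (R q) :> G (R q)"
      by (rule eventually_compose_filterlim)
    then show "\<forall>\<^sub>F q in nhds p. GDERIV (\<lambda>q. f (R q)) q :> inv R (G (R q))"
    proof eventually_elim
      case (elim q)
      then have "(f has_derivative (\<lambda>h. h \<bullet> G (R q))) (at (R q))" by (simp only: gderiv_def)
      from has_derivative_compose[OF bounded_linear_imp_has_derivative[OF R(1)] this] show ?case
        by (simp add: gderiv_def inner_inv)
    qed
    show "((\<lambda>q. inv R (G (R q))) has_derivative (\<lambda>h. inv R (D (R h)))) (at p)"
      using has_derivative_compose[OF bounded_linear_imp_has_derivative[OF R(1)] G(2)]
      by (rule bounded_linear.has_derivative[OF R(2)])
    show "L = (\<Sum>b\<in>Basis. inv R (D (R b)) \<bullet> b)"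
      using trace_orthogonal_transformation[OF has_derivative_linear[OF G(2)] assms(2)]
      by (simp add: G(4) inner_commute[of "inv R _"] inner_inv inner_commute[of "D _"])
  qed (simp add: G(3))
qed

lemma GDERIV_grad:
  assumes "f differentiable (at p)"
  shows "GDERIV f p :> grad f p"
proof -
  have D: "(f has_derivative frechet_derivative f (at p)) (at p)"
    using assms by (simp add: frechet_derivative_works)
  have "frechet_derivative f (at p) = (\<lambda>h. h \<bullet> grad f p)"
  proof
    fix h
    have "frechet_derivative f (at p) h =
        frechet_derivative f (at p) (\<Sum>b\<in>Basis. (h \<bullet> b) *\<^sub>R b)"
      by (simp add: euclidean_representation)
    also have "\<dots> = h \<bullet> grad f p"
      using has_derivative_linear[OF D]
      by (simp add: grad_def linear_sum linear_scale inner_sum_right mult.commute)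
    finally show "frechet_derivative f (at p) h = h \<bullet> grad f p" .
  qed
  with D show ?thesis by (simp only: gderiv_def)
qed

lemma C2_on_has_gradient_laplacian:
  assumes "C2_on S f" "open S" "p \<in> S"
  shows "has_gradient_laplacian f (grad f p) (laplacian f p) p"
proof (rule has_gradient_laplacianI)
  have "\<forall>\<^sub>F q in nhds p. q \<in> S" using assms(2,3) by (rule eventually_nhds_in_open)
  then show "\<forall>\<^sub>F q in nhds p. GDERIV f q :> grad f q"
    by eventually_elim (use assms(1) in \<open>auto simp: C2_on_def intro: GDERIV_grad\<close>)
  show "(grad f has_derivative frechet_derivative (grad f) (at p)) (at p)"
    using assms by (simp add: C2_on_def frechet_derivative_works)
qed (simp_all add: laplacian_def)

lemma GDERIV_along_line:
  assumes "GDERIV f (p + s *\<^sub>R v) :> g"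
  shows "DERIV (\<lambda>s. f (p + s *\<^sub>R v)) s :> v \<bullet> g"
proof -
  have "((\<lambda>s. p + s *\<^sub>R v) has_derivative (\<lambda>h. h *\<^sub>R v)) (at s)"
    by (auto intro!: derivative_eq_intros)
  moreover have "(f has_derivative (\<lambda>h. h \<bullet> g)) (at (p + s *\<^sub>R v))"
    using assms by (simp only: gderiv_def)
  ultimately have "((\<lambda>s. f (p + s *\<^sub>R v)) has_derivative (\<lambda>h. h *\<^sub>R v \<bullet> g)) (at s)"
    by (rule has_derivative_compose)
  then show ?thesis by (simp add: has_field_derivative_def mult_commute_abs)
qed

lemma second_derivative_nonpos_at_local_max:
  fixes f :: "real \<Rightarrow> real"
  assumes f: "\<forall>\<^sub>F s in nhds a. DERIV f s :> f' s" and f': "DERIV f' a :> d"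
    and max: "\<forall>\<^sub>F s in nhds a. f s \<le> f a"
  shows "d \<le> 0"
proof (rule ccontr)
  assume "\<not> d \<le> 0"
  with DERIV_pos_inc_right[OF f'] obtain e where e: "0 < e"
    "\<And>h. 0 < h \<Longrightarrow> h < e \<Longrightarrow> f' a < f' (a + h)" by auto
  obtain r where r: "0 < r"
    "\<And>s. dist s a < r \<Longrightarrow> DERIV f s :> f' s \<and> f s \<le> f a"
    using eventually_conj[OF f max] unfolding eventually_nhds_metric by blast
  have crit: "f' a = 0"
    by (rule DERIV_local_max[of f _ a r]) (use r in \<open>auto simp: dist_real_def abs_minus_commute\<close>)
  define h where "h = min r e / 2"
  have h: "0 < h" "h < r" "h < e" using r e by (auto simp: h_def min_def)
  have "f a < f (a + h)"
  proof (rule DERIV_pos_imp_increasing_open[of a "a + h"])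
    show "\<exists>y. DERIV f s :> y \<and> 0 < y" if "a < s" "s < a + h" for s
      using r(2)[of s] e(2)[of "s - a"] that h crit by (auto simp: dist_real_def)
    show "continuous_on {a..a + h} f"
      using r(2) h by (intro DERIV_atLeastAtMost_imp_continuous_on) (force simp: dist_real_def)
  qed (use h in simp)
  with r(2)[of "a + h"] h show False by (simp add: dist_real_def)
qed

lemma laplacian_nonpos_at_local_max:
  assumes "has_gradient_laplacian f g L p" and max: "\<forall>\<^sub>F q in nhds p. f q \<le> f p"
  shows "L \<le> 0"
proof -
  obtain G D where G: "\<forall>\<^sub>F q in nhds p. GDERIV f q :> G q" "(G has_derivative D) (at p)"
    "L = (\<Sum>b\<in>Basis. D b \<bullet> b)"
    by (rule has_gradient_laplacianE[OF assms(1)])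
  have "D b \<bullet> b \<le> 0" for b
  proof (rule second_derivative_nonpos_at_local_max)
    let ?l = "\<lambda>s::real. p + s *\<^sub>R b"
    have "(?l \<longlongrightarrow> p + 0 *\<^sub>R b) (nhds 0)" by (intro tendsto_intros filterlim_ident)
    then have l: "filterlim ?l (nhds p) (nhds 0)" by simp
    show "\<forall>\<^sub>F s in nhds 0. f (?l s) \<le> f (?l 0)"
      using eventually_compose_filterlim[OF max l] by simp
    show "\<forall>\<^sub>F s in nhds 0. DERIV (\<lambda>s. f (?l s)) s :> b \<bullet> G (?l s)"
      using eventually_compose_filterlim[OF G(1) l] by eventually_elim (rule GDERIV_along_line)
    have "(?l has_derivative (\<lambda>h. h *\<^sub>R b)) (at 0)" by (auto intro!: derivative_eq_intros)
    from has_derivative_compose[OF this, of G D]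
    have "((\<lambda>s. b \<bullet> G (?l s)) has_derivative (\<lambda>h. b \<bullet> D (h *\<^sub>R b))) (at 0)"
      using G(2) by (intro has_derivative_inner_right) simp
    then show "DERIV (\<lambda>s. b \<bullet> G (?l s)) 0 :> D b \<bullet> b"
      by (simp add: has_field_derivative_def linear_scale[OF has_derivative_linear[OF G(2)]]
          mult_commute_abs inner_commute)
  qed
  then show ?thesis by (simp add: G(3) sum_nonpos)
qed

lemma maximum_principle:
  fixes V :: "'a::euclidean_space \<Rightarrow> real"
  assumes "compact D" "continuous_on D V" "p \<in> D"
    and strict: "\<And>q. q \<in> D \<Longrightarrow> 0 < V q \<Longrightarrow>
      q \<in> interior D \<and> (\<exists>g L. has_gradient_laplacian V g L q \<and> 0 < L) \<or>
      (\<exists>v d. (\<forall>\<^sub>F h in at_right 0. q + h *\<^sub>R v \<in> D) \<and>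
             ((\<lambda>h. V (q + h *\<^sub>R v)) has_real_derivative d) (at_right 0) \<and> 0 < d)"
  shows "V p \<le> 0"
proof (rule ccontr)
  assume "\<not> V p \<le> 0"
  obtain q where q: "q \<in> D" and max: "\<And>q'. q' \<in> D \<Longrightarrow> V q' \<le> V q"
    using continuous_attains_sup[OF assms(1) _ assms(2)] assms(3) by blast
  have "0 < V q" using max[OF assms(3)] \<open>\<not> V p \<le> 0\<close> by simp
  with strict[OF q] consider
      (interior) g L where "q \<in> interior D" "has_gradient_laplacian V g L q" "0 < L"
    | (boundary) v d where "\<forall>\<^sub>F h in at_right 0. q + h *\<^sub>R v \<in> D"
        "((\<lambda>h. V (q + h *\<^sub>R v)) has_real_derivative d) (at_right 0)" "0 < d"
    by blast
  then show False
  proof cases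
    case interior
    have "\<forall>\<^sub>F q' in nhds q. q' \<in> interior D"
      using interior(1) by (intro eventually_nhds_in_open) auto
    then have "\<forall>\<^sub>F q' in nhds q. V q' \<le> V q"
      by eventually_elim (use max interior_subset in blast)
    then show False using laplacian_nonpos_at_local_max interior(2,3) by fastforce
  next
    case boundary
    obtain e where e: "0 < e" "\<And>h. 0 < h \<Longrightarrow> h < e \<Longrightarrow> V q < V (q + h *\<^sub>R v)"
      using has_real_derivative_pos_inc_right[OF boundary(2,3)] by auto
    obtain r where r: "0 < r" "\<And>h. 0 < h \<Longrightarrow> h < r \<Longrightarrow> q + h *\<^sub>R v \<in> D"
      using boundary(1) by (auto simp: eventually_at_right_field)
    define h where "h = min e r / 2"
    have "0 < h" "h < e" "h < r" using e r by (auto simp: h_def min_def)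
    then show False using e(2) r(2) max by fastforce
  qed
qed

section \<open>The exterior of the two balls\<close>

definition axis_sqdist :: "real^3 \<Rightarrow> real" where
  "axis_sqdist p = (p $ 2)\<^sup>2 + (p $ 3)\<^sup>2"

lemma axis_sqdist_nonneg [simp]: "0 \<le> axis_sqdist p"
  by (simp add: axis_sqdist_def)

lemma norm_eq_axis_sqdist: "(norm p)\<^sup>2 = (p $ 1)\<^sup>2 + axis_sqdist p"
  by (simp add: axis_sqdist_def norm_eq_sqrt_inner inner_vec_def sum_3 power2_eq_square)

lemma center_nth [simp]:
  "center1 \<epsilon> $ 1 = - 1 - \<epsilon> / 2" "center1 \<epsilon> $ 2 = 0" "center1 \<epsilon> $ 3 = 0"
  "center2 \<epsilon> $ 1 = 1 + \<epsilon> / 2" "center2 \<epsilon> $ 2 = 0" "center2 \<epsilon> $ 3 = 0"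
  by (simp_all add: center1_def center2_def)

lemma dist_center_sq:
  assumes "c \<in> {center1 \<epsilon>, center2 \<epsilon>}"
  shows "(dist c p)\<^sup>2 = (p $ 1 - c $ 1)\<^sup>2 + axis_sqdist p"
  using assms norm_eq_axis_sqdist[of "p - c"]
  by (auto simp: dist_norm norm_minus_commute axis_sqdist_def)

lemma min_dist_center_sq:
  assumes "0 < \<epsilon>"
  shows "min ((dist (center1 \<epsilon>) p)\<^sup>2) ((dist (center2 \<epsilon>) p)\<^sup>2)
    = (1 + \<epsilon> / 2 - \<bar>p $ 1\<bar>)\<^sup>2 + axis_sqdist p"
proof -
  let ?a = "1 + \<epsilon> / 2"
  have c: "(dist (center1 \<epsilon>) p)\<^sup>2 = (?a + p $ 1)\<^sup>2 + axis_sqdist p"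
    "(dist (center2 \<epsilon>) p)\<^sup>2 = (?a - p $ 1)\<^sup>2 + axis_sqdist p"
    using dist_center_sq[of "center1 \<epsilon>" \<epsilon> p] dist_center_sq[of "center2 \<epsilon>" \<epsilon> p]
    by (simp_all add: power2_eq_square algebra_simps)
  have expand: "(?a + p $ 1)\<^sup>2 = (?a - p $ 1)\<^sup>2 + 4 * (?a * p $ 1)"
    by (simp add: power2_eq_square algebra_simps)
  show ?thesis
  proof (cases "0 \<le> p $ 1")
    case True
    then have "0 \<le> ?a * p $ 1" using assms by simp
    then show ?thesis unfolding c expand using True by simp
  next
    case False
    then have "?a * p $ 1 \<le> 0" using assms by (intro mult_nonneg_nonpos) auto
    then show ?thesis unfolding c using expand False by simp
  qed
qed

lemma exterior_eq: "exterior \<epsilon> = {p. 1 < dist (center1 \<epsilon>) p \<and> 1 < dist (center2 \<epsilon>) p}"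
  by (auto simp: exterior_def closure_Un not_le)

lemma open_exterior: "open (exterior \<epsilon>)"
  by (simp add: exterior_def open_Int open_Compl)

lemma normal_ray_in_exterior:
  assumes "0 < \<epsilon>" "c \<in> {center1 \<epsilon>, center2 \<epsilon>}" "p \<in> sphere c 1" "0 < h" "h < \<epsilon>"
  shows "p + h *\<^sub>R (p - c) \<in> exterior \<epsilon>"
proof -
  let ?q = "p + h *\<^sub>R (p - c)"
  have "norm (p - c) = 1" using assms(3) by (simp add: dist_norm norm_minus_commute)
  moreover have "?q - c = (1 + h) *\<^sub>R (p - c)" by (simp add: algebra_simps)
  ultimately have c: "dist c ?q = 1 + h"
    using assms(4) by (simp add: dist_norm norm_minus_commute[of c])
  have "1 < dist c' ?q" if "c' \<in> {center1 \<epsilon>, center2 \<epsilon>}" "c' \<noteq> c" for c'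
  proof -
    have "(dist c' c)\<^sup>2 = (2 + \<epsilon>)\<^sup>2"
      using that assms(2) unfolding dist_center_sq[OF that(1)]
      by (auto simp: axis_sqdist_def power2_eq_square field_simps)
    then have "dist c' c = 2 + \<epsilon>" using assms(1) by simp
    then show ?thesis using dist_triangle2[of c' c ?q] c assms(5) by simp
  qed
  with c assms(2,4) show ?thesis unfolding exterior_eq by fastforce
qed

lemma eventually_normal_ray_in_exterior:
  assumes "0 < \<epsilon>" "c \<in> {center1 \<epsilon>, center2 \<epsilon>}" "p \<in> sphere c 1"
  shows "\<forall>\<^sub>F h in at_right 0. p + h *\<^sub>R (p - c) \<in> exterior \<epsilon>"
  unfolding eventually_at_right_field using normal_ray_in_exterior[OF assms] assms(1) by blast

lemma sphere_subset_closure_exterior: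
  assumes "0 < \<epsilon>" "c \<in> {center1 \<epsilon>, center2 \<epsilon>}"
  shows "sphere c 1 \<subseteq> closure (exterior \<epsilon>)"
proof
  fix p assume p: "p \<in> sphere c 1"
  have "((\<lambda>h. p + h *\<^sub>R (p - c)) \<longlongrightarrow> p + 0 *\<^sub>R (p - c)) (at_right 0)"
    by (intro tendsto_intros)
  moreover have "\<forall>\<^sub>F h in at_right 0. p + h *\<^sub>R (p - c) \<in> closure (exterior \<epsilon>)"
    using eventually_normal_ray_in_exterior[OF assms p]
    by eventually_elim (use closure_subset in blast)
  ultimately show "p \<in> closure (exterior \<epsilon>)"
    by (intro Lim_in_closed_set[OF closed_closure]) auto
qed

lemma closure_exterior:
  assumes "0 < \<epsilon>"
  shows "closure (exterior \<epsilon>) = {p. 1 \<le> dist (center1 \<epsilon>) p \<and> 1 \<le> dist (center2 \<epsilon>) p}" (is "_ = ?E")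
proof
  have "closed ?E" by (intro closed_Collect_conj closed_Collect_le continuous_intros)
  then show "closure (exterior \<epsilon>) \<subseteq> ?E" by (intro closure_minimal) (auto simp: exterior_eq)
  show "?E \<subseteq> closure (exterior \<epsilon>)"
  proof
    fix p assume "p \<in> ?E"
    then have "p \<in> exterior \<epsilon> \<or> p \<in> sphere (center1 \<epsilon>) 1 \<or> p \<in> sphere (center2 \<epsilon>) 1"
      by (auto simp: exterior_eq)
    then show "p \<in> closure (exterior \<epsilon>)"
      using sphere_subset_closure_exterior[OF assms] closure_subset by blast
  qed
qed

lemma closure_exterior_cases:
  assumes "0 < \<epsilon>" "p \<in> closure (exterior \<epsilon>)"
  obtains (exterior) "p \<in> exterior \<epsilon>"
    | (sphere) c where "c \<in> {center1 \<epsilon>, center2 \<epsilon>}" "p \<in> sphere c 1"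
proof -
  have "p \<in> exterior \<epsilon> \<or> p \<in> sphere (center1 \<epsilon>) 1 \<or> p \<in> sphere (center2 \<epsilon>) 1"
    using assms(2) unfolding closure_exterior[OF assms(1)] by (auto simp: exterior_eq)
  then show thesis using that by blast
qed

lemma mem_exterior_iff:
  assumes "0 < \<epsilon>"
  shows "p \<in> exterior \<epsilon> \<longleftrightarrow> 1 < (1 + \<epsilon> / 2 - \<bar>p $ 1\<bar>)\<^sup>2 + axis_sqdist p"
    and "p \<in> closure (exterior \<epsilon>) \<longleftrightarrow> 1 \<le> (1 + \<epsilon> / 2 - \<bar>p $ 1\<bar>)\<^sup>2 + axis_sqdist p"
proof -
  have "1 < (dist c p)\<^sup>2 \<longleftrightarrow> 1 < dist c p" "1 \<le> (dist c p)\<^sup>2 \<longleftrightarrow> 1 \<le> dist c p" for c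
    unfolding power2_gt_1_iff power2_ge_1_iff using zero_le_dist[of c p] by linarith+
  then show "p \<in> exterior \<epsilon> \<longleftrightarrow> 1 < (1 + \<epsilon> / 2 - \<bar>p $ 1\<bar>)\<^sup>2 + axis_sqdist p"
    and "p \<in> closure (exterior \<epsilon>) \<longleftrightarrow> 1 \<le> (1 + \<epsilon> / 2 - \<bar>p $ 1\<bar>)\<^sup>2 + axis_sqdist p"
    unfolding min_dist_center_sq[OF assms, symmetric] closure_exterior[OF assms]
    by (simp_all add: exterior_eq)
qed

lemma sphere_abscissa_bound:
  assumes "0 < \<epsilon>" "c \<in> {center1 \<epsilon>, center2 \<epsilon>}" "p \<in> sphere c 1"
  shows "- (axis_sqdist p + \<epsilon>) \<le> 2 * p $ 1 * (p $ 1 - c $ 1)"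
proof -
  define n where "n = p $ 1 - c $ 1"
  define t where "t = axis_sqdist p"
  have n: "n\<^sup>2 = 1 - t" using assms(3) dist_center_sq[OF assms(2), of p] by (simp add: n_def t_def)
  have t: "0 \<le> t" by (simp add: t_def)
  have "t \<le> 1" using n zero_le_power2[of n] by linarith
  have "\<bar>n\<bar> \<le> 1 - t / 2"
  proof (rule power2_le_imp_le)
    have "(1 - t / 2)\<^sup>2 = 1 - t + (t / 2)\<^sup>2" by (simp add: power2_eq_square algebra_simps)
    then show "\<bar>n\<bar>\<^sup>2 \<le> (1 - t / 2)\<^sup>2" by (simp add: n)
  qed (use \<open>t \<le> 1\<close> in simp)
  then have "\<bar>c $ 1\<bar> * \<bar>n\<bar> \<le> (1 + \<epsilon> / 2) * (1 - t / 2)"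
    using assms(1,2) by (intro mult_mono) auto
  then have "- ((1 + \<epsilon> / 2) * (1 - t / 2)) \<le> c $ 1 * n"
    by (simp add: abs_mult[symmetric] abs_le_iff)
  moreover have "2 * p $ 1 * n = 2 * n\<^sup>2 + 2 * (c $ 1 * n)"
    by (simp add: n_def power2_eq_square algebra_simps)
  moreover have "2 * (1 - t) - 2 * ((1 + \<epsilon> / 2) * (1 - t / 2)) = \<epsilon> * t / 2 - (t + \<epsilon>)"
    by (simp add: field_simps)
  moreover have "0 \<le> \<epsilon> * t / 2" using assms(1) t by simp
  ultimately show ?thesis unfolding n t_def[symmetric] n_def[symmetric] by linarith
qed

lemma gap_half_width:
  assumes "0 < \<epsilon>" "p \<in> closure (exterior \<epsilon>)" "\<bar>p $ 1\<bar> \<le> 1" "axis_sqdist p \<le> 1"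
  shows "\<bar>p $ 1\<bar> \<le> \<epsilon> / 2 + axis_sqdist p"
proof -
  let ?t = "axis_sqdist p" and ?w = "1 + \<epsilon> / 2 - \<bar>p $ 1\<bar>"
  have "1 - ?t \<le> ?w"
  proof (rule power2_le_imp_le)
    have "0 \<le> ?t * (1 - ?t)" using assms(4) by simp
    moreover have "(1 - ?t)\<^sup>2 = 1 - ?t - ?t * (1 - ?t)"
      by (simp add: power2_eq_square algebra_simps)
    ultimately show "(1 - ?t)\<^sup>2 \<le> ?w\<^sup>2"
      using mem_exterior_iff(2)[OF assms(1), of p] assms(2) by linarith
  qed (use assms in simp)
  then show ?thesis by linarith
qed

section \<open>The odd part of a solution\<close>

definition reflect_along :: "'a::real_inner \<Rightarrow> 'a \<Rightarrow> 'a" where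
  "reflect_along b p = p - (2 * (p \<bullet> b)) *\<^sub>R b"

lemma reflect_along_involution:
  assumes "norm b = 1"
  shows "reflect_along b (reflect_along b p) = p"
  using assms by (simp add: reflect_along_def inner_diff_left dot_square_norm)

lemma orthogonal_transformation_reflect_along:
  assumes "norm b = 1"
  shows "orthogonal_transformation (reflect_along b)"
  unfolding orthogonal_transformation_def
proof (intro conjI allI)
  show "linear (reflect_along b)"
    by (rule linearI) (simp_all add: reflect_along_def inner_add_left algebra_simps)
  show "reflect_along b v \<bullet> reflect_along b w = v \<bullet> w" for v w
    using assms by (simp add: reflect_along_def inner_diff_left inner_diff_right inner_commute[of b]
        dot_square_norm)
qed

lemma inv_reflect_along:
  assumes "norm b = 1"
  shows "inv (reflect_along b) = reflect_along b"
  by (rule inv_unique_comp) (simp_all add: fun_eq_iff reflect_along_involution[OF assms])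

abbreviation yreflect :: "real^3 \<Rightarrow> real^3" where
  "yreflect \<equiv> reflect_along (axis 2 1)"

lemma yreflect_nth [simp]:
  "yreflect p $ 1 = p $ 1" "yreflect p $ 2 = - p $ 2" "yreflect p $ 3 = p $ 3"
  by (simp_all add: reflect_along_def inner_axis) (simp_all add: axis_def)

lemma yreflect_fixes:
  assumes "p $ 2 = 0"
  shows "yreflect p = p"
  using assms by (simp add: reflect_along_def inner_axis)

lemma orthogonal_transformation_yreflect: "orthogonal_transformation yreflect"
  by (simp add: orthogonal_transformation_reflect_along)

lemma yreflect_mem_iff:
  assumes "0 < \<epsilon>"
  shows "yreflect p \<in> exterior \<epsilon> \<longleftrightarrow> p \<in> exterior \<epsilon>"
    and "yreflect p \<in> closure (exterior \<epsilon>) \<longleftrightarrow> p \<in> closure (exterior \<epsilon>)"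
  using assms by (simp_all add: mem_exterior_iff axis_sqdist_def)

lemma normal_derivative_of_has_derivative:
  assumes "0 < \<epsilon>" "c \<in> {center1 \<epsilon>, center2 \<epsilon>}" "p \<in> sphere c 1"
    and "(u has_derivative (\<lambda>h. g \<bullet> h)) (at p within closure (exterior \<epsilon>))"
  shows "((\<lambda>h. u (p + h *\<^sub>R (p - c))) has_real_derivative g \<bullet> (p - c)) (at_right 0)"
proof -
  let ?l = "\<lambda>h. p + h *\<^sub>R (p - c)"
  have line: "(?l has_derivative (\<lambda>h. h *\<^sub>R (p - c))) (at 0 within {0<..<\<epsilon>})"
    by (auto intro!: derivative_eq_intros)
  have "?l ` {0<..<\<epsilon>} \<subseteq> closure (exterior \<epsilon>)"
    using normal_ray_in_exterior[OF assms(1-3)] closure_subset by fastforce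
  then have "(u has_derivative (\<lambda>h. g \<bullet> h)) (at (?l 0) within ?l ` {0<..<\<epsilon>})"
    using has_derivative_subset[OF assms(4)] by simp
  from has_derivative_in_compose[OF line this]
  have "((\<lambda>h. u (?l h)) has_real_derivative g \<bullet> (p - c)) (at 0 within {0<..<\<epsilon>})"
    by (simp add: has_field_derivative_def mult_commute_abs)
  moreover have "at 0 within {0<..<\<epsilon>} = at_right 0"
    by (rule at_within_nhd[of _ "{..<\<epsilon>}"]) (use assms(1) in auto)
  ultimately show ?thesis by simp
qed

locale two_ball_solution =
  fixes \<epsilon> :: real and u :: "real^3 \<Rightarrow> real"
  assumes eps_pos: "0 < \<epsilon>"
    and solution: "insulated_solution \<epsilon> (\<lambda>p. p $ 2) u"
begin

definition U :: "real^3 \<Rightarrow> real" where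
  "U p = 1/2 * (u p - u (yreflect p))"

lemma U_eq_0: "p $ 2 = 0 \<Longrightarrow> U p = 0"
  by (simp add: U_def yreflect_fixes)

lemma continuous_on_U: "continuous_on (closure (exterior \<epsilon>)) U"
proof -
  obtain G where "\<forall>p\<in>closure (exterior \<epsilon>).
      (u has_derivative (\<lambda>h. G p \<bullet> h)) (at p within closure (exterior \<epsilon>))"
    using solution unfolding insulated_solution_def by blast
  then have u: "continuous_on (closure (exterior \<epsilon>)) u"
    unfolding continuous_on_eq_continuous_within using has_derivative_continuous by blast
  have "linear yreflect"
    using orthogonal_transformation_yreflect by (rule orthogonal_transformation_linear)
  then have "continuous_on (closure (exterior \<epsilon>)) (\<lambda>p. u (yreflect p))"
    by (intro continuous_on_compose2[OF u linear_continuous_on])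
      (auto simp: linear_conv_bounded_linear[symmetric] yreflect_mem_iff[OF eps_pos])
  with u show ?thesis unfolding U_def by (intro continuous_intros)
qed

lemma has_gradient_laplacian_U:
  assumes "p \<in> exterior \<epsilon>"
  shows "has_gradient_laplacian U ((1/2) *\<^sub>R (grad u p - yreflect (grad u (yreflect p)))) 0 p"
proof -
  have u: "has_gradient_laplacian u (grad u q) 0 q" if "q \<in> exterior \<epsilon>" for q
  proof -
    have "C2_on (exterior \<epsilon>) u" "laplacian u q = 0"
      using solution that by (simp_all add: insulated_solution_def harmonic_on_def)
    then show ?thesis using C2_on_has_gradient_laplacian[OF _ open_exterior that] by metis
  qed
  have "yreflect p \<in> exterior \<epsilon>" using assms by (simp add: yreflect_mem_iff eps_pos)
  from has_gradient_laplacian_compose_orthogonal[OF u[OF this] orthogonal_transformation_yreflect]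
  have "has_gradient_laplacian (\<lambda>q. u (yreflect q)) (yreflect (grad u (yreflect p))) 0 p"
    by (simp add: inv_reflect_along)
  from has_gradient_laplacian_cmult[OF has_gradient_laplacian_diff[OF u[OF assms] this], of "1/2"]
  show ?thesis by (simp add: U_def[abs_def])
qed

lemma U_neumann:
  assumes "c \<in> {center1 \<epsilon>, center2 \<epsilon>}" "p \<in> sphere c 1"
  shows "((\<lambda>h. U (p + h *\<^sub>R (p - c))) has_real_derivative 0) (at_right 0)"
proof -
  have u: "((\<lambda>h. u (q + h *\<^sub>R (q - c))) has_real_derivative 0) (at_right 0)"
    if "q \<in> sphere c 1" for q
  proof -
    obtain G where G: "\<forall>p\<in>closure (exterior \<epsilon>).
        (u has_derivative (\<lambda>h. G p \<bullet> h)) (at p within closure (exterior \<epsilon>))"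
      and N: "\<forall>c\<in>{center1 \<epsilon>, center2 \<epsilon>}. \<forall>p\<in>sphere c 1. G p \<bullet> (p - c) = 0"
      using solution unfolding insulated_solution_def by blast
    have "q \<in> closure (exterior \<epsilon>)"
      using sphere_subset_closure_exterior[OF eps_pos assms(1)] that by blast
    with G have "(u has_derivative (\<lambda>h. G q \<bullet> h)) (at q within closure (exterior \<epsilon>))" by blast
    moreover have "G q \<bullet> (q - c) = 0" using N assms(1) that by blast
    ultimately show ?thesis
      using normal_derivative_of_has_derivative[OF eps_pos assms(1) that] by metis
  qed
  have R: "linear yreflect" "\<And>v. norm (yreflect v) = norm v"
    using orthogonal_transformation_yreflect by (simp_all add: orthogonal_transformation)
  have c: "yreflect c = c" using assms(1) by (intro yreflect_fixes) auto
  then have "yreflect (p + h *\<^sub>R (p - c)) = yreflect p + h *\<^sub>R (yreflect p - c)" for h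
    using R(1) by (simp add: linear_add linear_scale linear_diff)
  moreover have "yreflect p \<in> sphere c 1"
    using assms(2) R(2)[of "c - p"] R(1) c by (simp add: dist_norm linear_diff)
  ultimately show ?thesis
    using DERIV_cmult[OF DERIV_diff[OF u[OF assms(2)] u[of "yreflect p"]], of "1/2"]
    by (simp add: U_def)
qed

lemma U_tendsto_y: "((\<lambda>p. U p - p $ 2) \<longlongrightarrow> 0) at_infinity"
proof -
  have decay: "(\<lambda>p. u p - p $ 2) \<in> O[at_infinity](\<lambda>p. 1 / norm p ^ 2)"
    using solution by (simp add: insulated_solution_def)
  have "((\<lambda>p :: real^3. 1 / norm p ^ 2) \<longlongrightarrow> 0) at_infinity"
    by (intro tendsto_divide_0[OF tendsto_const] filterlim_at_top_imp_at_infinity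
        filterlim_pow_at_top filterlim_norm_at_top) simp
  then have "(\<lambda>p :: real^3. 1 / norm p ^ 2) \<in> o[at_infinity](\<lambda>_. 1)"
    by (intro smalloI_tendsto) simp_all
  from smalloD_tendsto[OF landau_o.big_small_trans[OF decay this]]
  have u: "((\<lambda>p. u p - p $ 2) \<longlongrightarrow> 0) at_infinity" by simp
  have "filterlim yreflect at_infinity at_infinity"
    using filterlim_norm_at_top orthogonal_transformation_yreflect
    by (simp add: filterlim_at_infinity_conv_norm_at_top orthogonal_transformation)
  from tendsto_mult_left[OF tendsto_diff[OF u filterlim_compose[OF u this]], of "1/2"]
  show ?thesis by (simp add: U_def algebra_simps)
qed

lemma normal_derivative_minus_U:
  assumes "c \<in> {center1 \<epsilon>, center2 \<epsilon>}" "q \<in> sphere c 1" "GDERIV W q :> g"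
  shows "((\<lambda>h. W (q + h *\<^sub>R (q - c)) - k * U (q + h *\<^sub>R (q - c))) has_real_derivative (q - c) \<bullet> g)
    (at_right 0)"
proof -
  have "((\<lambda>h. W (q + h *\<^sub>R (q - c))) has_real_derivative (q - c) \<bullet> g) (at_right 0)"
    by (rule has_field_derivative_at_within, rule GDERIV_along_line) (simp add: assms(3))
  from DERIV_diff[OF this DERIV_cmult[OF U_neumann[OF assms(1,2)], of k]] show ?thesis by simp
qed

lemma comparison_principle:
  assumes "compact E" "open \<Omega>" "\<Omega> \<subseteq> E"
    and cont: "continuous_on (E \<inter> closure (exterior \<epsilon>)) W"
    and boundary: "\<And>q. q \<in> E - \<Omega> \<Longrightarrow> q \<in> closure (exterior \<epsilon>) \<Longrightarrow> W q \<le> k * U q"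
    and subharmonic: "\<And>q. q \<in> \<Omega> \<Longrightarrow> q \<in> exterior \<epsilon> \<Longrightarrow>
      \<exists>g L. has_gradient_laplacian W g L q \<and> 0 < L"
    and outflow: "\<And>q c. q \<in> \<Omega> \<Longrightarrow> c \<in> {center1 \<epsilon>, center2 \<epsilon>} \<Longrightarrow> q \<in> sphere c 1 \<Longrightarrow>
      \<exists>g. GDERIV W q :> g \<and> 0 < (q - c) \<bullet> g"
    and p: "p \<in> E" "p \<in> closure (exterior \<epsilon>)"
  shows "W p \<le> k * U p"
proof -
  let ?D = "E \<inter> closure (exterior \<epsilon>)" and ?V = "\<lambda>q. W q - k * U q"
  have \<Omega>: "\<Omega> \<inter> exterior \<epsilon> \<subseteq> ?D" using assms(3) closure_subset by blast
  have "?V p \<le> 0"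
  proof (rule maximum_principle[where D = ?D])
    show "compact ?D" using assms(1) by (simp add: compact_Int_closed)
    show "continuous_on ?D ?V"
      by (intro continuous_intros cont continuous_on_subset[OF continuous_on_U]) auto
    show "p \<in> ?D" using p by simp
    fix q assume q: "q \<in> ?D" "0 < ?V q"
    then have "q \<in> \<Omega>" using boundary by force
    have "q \<in> closure (exterior \<epsilon>)" using q by simp
    with eps_pos show "q \<in> interior ?D \<and> (\<exists>g L. has_gradient_laplacian ?V g L q \<and> 0 < L) \<or>
        (\<exists>v d. (\<forall>\<^sub>F h in at_right 0. q + h *\<^sub>R v \<in> ?D) \<and>
          ((\<lambda>h. ?V (q + h *\<^sub>R v)) has_real_derivative d) (at_right 0) \<and> 0 < d)"
    proof (cases rule: closure_exterior_cases)
      case exterior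
      have "q \<in> interior ?D"
        using \<open>q \<in> \<Omega>\<close> exterior \<Omega> assms(2) open_exterior by (meson IntI interiorI open_Int)
      moreover obtain g L where g: "has_gradient_laplacian W g L q" "0 < L"
        using subharmonic[OF \<open>q \<in> \<Omega>\<close> exterior] by blast
      ultimately show ?thesis
        using has_gradient_laplacian_diff[OF g(1)
            has_gradient_laplacian_cmult[OF has_gradient_laplacian_U[OF exterior]], of k] by auto
    next
      case (sphere c)
      have "((\<lambda>h. q + h *\<^sub>R (q - c)) \<longlongrightarrow> q + 0 *\<^sub>R (q - c)) (at_right 0)" by (intro tendsto_intros)
      then have "\<forall>\<^sub>F h in at_right 0. q + h *\<^sub>R (q - c) \<in> \<Omega>"
        using topological_tendstoD[OF _ assms(2)] \<open>q \<in> \<Omega>\<close> by simp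
      with eventually_normal_ray_in_exterior[OF eps_pos sphere]
      have "\<forall>\<^sub>F h in at_right 0. q + h *\<^sub>R (q - c) \<in> ?D"
        by eventually_elim (use \<Omega> in blast)
      moreover obtain g where "GDERIV W q :> g" "0 < (q - c) \<bullet> g"
        using outflow[OF \<open>q \<in> \<Omega>\<close> sphere] by auto
      ultimately show ?thesis using normal_derivative_minus_U[OF sphere] by blast
    qed
  qed
  then show ?thesis by simp
qed

end

section \<open>Comparison functions\<close>

lemma has_gradient_laplacian_nth:
  "has_gradient_laplacian (\<lambda>q :: real^'n. q $ i) (axis i 1) 0 p"
  using has_gradient_laplacian_inner[of "axis i 1" p] by (simp add: inner_axis)

lemma has_gradient_laplacian_axis_sqdist:
  "has_gradient_laplacian axis_sqdist
    ((2 :: real) *\<^sub>R (p $ 2 *\<^sub>R axis 2 1 + p $ 3 *\<^sub>R axis 3 1)) 4 p"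
proof -
  have sq: "has_gradient_laplacian (\<lambda>q. q $ i * q $ i) ((2 * p $ i) *\<^sub>R axis i 1) 2 p" for i
    by (rule has_gradient_laplacian_eq_rhs[OF has_gradient_laplacian_mult[OF
            has_gradient_laplacian_nth has_gradient_laplacian_nth]])
      (simp_all add: inner_axis_axis scaleR_add_left[symmetric])
  have "axis_sqdist = (\<lambda>q. q $ 2 * q $ 2 + q $ 3 * q $ 3)"
    by (simp add: fun_eq_iff axis_sqdist_def power2_eq_square)
  then show ?thesis
    using has_gradient_laplacian_add[OF sq[of 2] sq[of 3]] by (simp add: scaleR_add_right)
qed

lemma has_gradient_laplacian_y_times_axial:
  fixes p :: "real^3"
  defines "x \<equiv> p $ 1" and "y \<equiv> p $ 2" and "z \<equiv> p $ 3" and "t \<equiv> axis_sqdist p"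
  assumes F: "has_gradient_laplacian F F' F'' t" and K: "has_gradient_laplacian K K' K'' t"
  shows "has_gradient_laplacian
    (\<lambda>q. q $ 2 * (F (axis_sqdist q) + (q $ 1)\<^sup>2 * K (axis_sqdist q)))
    ((F t + x\<^sup>2 * K t) *\<^sub>R axis 2 1
      + y *\<^sub>R ((2 * (F' + x\<^sup>2 * K')) *\<^sub>R (y *\<^sub>R axis 2 1 + z *\<^sub>R axis 3 1)
        + (2 * x * K t) *\<^sub>R axis 1 1))
    (y * (2 * K t + 8 * (F' + x\<^sup>2 * K') + 4 * t * (F'' + x\<^sup>2 * K''))) p"
proof -
  let ?r = "2 *\<^sub>R (y *\<^sub>R axis 2 1 + z *\<^sub>R axis 3 1) :: real^3"
  have t: "t = y * y + z * z" by (simp add: t_def y_def z_def axis_sqdist_def power2_eq_square)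
  have radial: "has_gradient_laplacian (\<lambda>q. \<phi> (axis_sqdist q)) (a *\<^sub>R ?r) (4 * t * b + 4 * a) p"
    if "has_gradient_laplacian \<phi> a b t" for \<phi> :: "real \<Rightarrow> real" and a b
    by (rule has_gradient_laplacian_eq_rhs[OF has_gradient_laplacian_compose_real[OF
            that[unfolded t_def] has_gradient_laplacian_axis_sqdist]])
      (simp_all add: y_def z_def t inner_add_left inner_add_right inner_axis_axis)
  have x2: "has_gradient_laplacian (\<lambda>q. q $ 1 * q $ 1) ((2 * x) *\<^sub>R axis 1 1) 2 p"
    by (rule has_gradient_laplacian_eq_rhs[OF has_gradient_laplacian_mult[OF
            has_gradient_laplacian_nth has_gradient_laplacian_nth]])
      (simp_all add: x_def inner_axis_axis scaleR_add_left[symmetric])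
  have "has_gradient_laplacian (\<lambda>q. F (axis_sqdist q) + q $ 1 * q $ 1 * K (axis_sqdist q))
      ((F' + x\<^sup>2 * K') *\<^sub>R ?r + (2 * x * K t) *\<^sub>R axis 1 1)
      (2 * K t + 4 * (F' + x\<^sup>2 * K') + 4 * t * (F'' + x\<^sup>2 * K'')) p"
    by (rule has_gradient_laplacian_eq_rhs[OF has_gradient_laplacian_add[OF
            radial[OF F] has_gradient_laplacian_mult[OF x2 radial[OF K]]]])
      (simp_all add: x_def t_def[symmetric] inner_add_right inner_axis_axis power2_eq_square
        algebra_simps)
  from has_gradient_laplacian_mult[OF has_gradient_laplacian_nth this]
  show ?thesis
    unfolding power2_eq_square
    by (rule has_gradient_laplacian_eq_rhs)
      (simp_all add: x_def y_def[symmetric] t_def[symmetric] inner_add_right inner_axis_axis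
        algebra_simps)
qed

lemma has_gradient_laplacian_y_plus_axis_sqdist:
  "has_gradient_laplacian (\<lambda>q. q $ 2 + \<delta> * axis_sqdist q + k)
    (axis 2 1 + (2 * \<delta>) *\<^sub>R (p $ 2 *\<^sub>R axis 2 1 + p $ 3 *\<^sub>R axis 3 1)) (4 * \<delta>) p"
  by (rule has_gradient_laplacian_eq_rhs[OF has_gradient_laplacian_add[OF
          has_gradient_laplacian_add[OF has_gradient_laplacian_nth
            has_gradient_laplacian_cmult[OF has_gradient_laplacian_axis_sqdist]]
          has_gradient_laplacian_const]])
    (simp_all add: mult.commute)

lemma y_plus_axis_sqdist_outflow:
  assumes "c \<in> {center1 \<epsilon>, center2 \<epsilon>}" "0 < p $ 2" "0 \<le> \<delta>"
  shows "\<exists>g. GDERIV (\<lambda>q. q $ 2 + \<delta> * axis_sqdist q + k) p :> g \<and> 0 < (p - c) \<bullet> g"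
proof (intro exI conjI)
  let ?g = "axis 2 1 + (2 * \<delta>) *\<^sub>R (p $ 2 *\<^sub>R axis 2 1 + p $ 3 *\<^sub>R axis 3 1)"
  show "GDERIV (\<lambda>q. q $ 2 + \<delta> * axis_sqdist q + k) p :> ?g"
    by (rule has_gradient_laplacian_GDERIV[OF has_gradient_laplacian_y_plus_axis_sqdist])
  have "0 < p $ 2 + 2 * \<delta> * axis_sqdist p" using assms(2,3) by (simp add: add_pos_nonneg)
  also have "\<dots> = (p - c) \<bullet> ?g"
    using assms(1)
    by (auto simp: inner_add_right inner_axis axis_sqdist_def power2_eq_square algebra_simps)
  finally show "0 < (p - c) \<bullet> ?g" .
qed

section \<open>The barrier in the neck\<close>

definition \<mu> :: real where
  "\<mu> = sqrt 2 / 2 - 1"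

lemma \<mu>_quadratic: "2 * \<mu>\<^sup>2 + 4 * \<mu> + 1 = 0"
  by (simp add: \<mu>_def power2_eq_square algebra_simps)

lemma \<mu>_bounds: "- 0.3 < \<mu>" "\<mu> < - 0.29"
proof -
  have "1.4 < sqrt 2" by (rule real_less_rsqrt) (simp add: power2_eq_square)
  moreover have "sqrt 2 < 1.42" by (rule real_less_lsqrt) (simp_all add: power2_eq_square)
  ultimately show "- 0.3 < \<mu>" "\<mu> < - 0.29" by (simp_all add: \<mu>_def)
qed

text \<open>
  \<open>\<alpha>\<close> and \<open>\<beta>\<close> are chosen so that the leading part of the Laplacian of the neck barrier vanishes,
  see \<open>neck_laplacian_pos\<close>. With \<open>\<tau> = s + 2 \<epsilon>\<close> and \<open>e = \<epsilon> / \<tau>\<close>, the function \<open>neck_K \<epsilon>\<close> and its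
  first two derivatives at \<open>s\<close> are \<open>\<tau>\<^sup>\<mu> \<kappa> \<tau> e / \<tau>\<close>, \<open>\<tau>\<^sup>\<mu> \<kappa>' \<tau> e / \<tau>\<^sup>2\<close> and \<open>\<tau>\<^sup>\<mu> \<kappa>'' \<tau> e / \<tau>\<^sup>3\<close>.
\<close>

definition \<alpha> :: real where
  "\<alpha> = - 2 * \<mu> * (\<mu> + 1)"

definition \<beta> :: real where
  "\<beta> = 4 * \<mu> * (\<mu> - 1)"

definition \<kappa> :: "real \<Rightarrow> real \<Rightarrow> real" where
  "\<kappa> \<tau> e = \<alpha> + \<beta> * e + 20 * \<tau>"

definition \<kappa>' :: "real \<Rightarrow> real \<Rightarrow> real" where
  "\<kappa>' \<tau> e = \<alpha> * (\<mu> - 1) + \<beta> * (\<mu> - 2) * e + 20 * \<mu> * \<tau>"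

definition \<kappa>'' :: "real \<Rightarrow> real \<Rightarrow> real" where
  "\<kappa>'' \<tau> e = \<alpha> * (\<mu> - 1) * (\<mu> - 2) + \<beta> * (\<mu> - 2) * (\<mu> - 3) * e + 20 * \<mu> * (\<mu> - 1) * \<tau>"

definition neck_F :: "real \<Rightarrow> real \<Rightarrow> real" where
  "neck_F \<epsilon> s = (s + 2 * \<epsilon>) powr \<mu> + 30"

definition neck_K :: "real \<Rightarrow> real \<Rightarrow> real" where
  "neck_K \<epsilon> s = \<alpha> * (s + 2 * \<epsilon>) powr (\<mu> - 1) + (\<beta> * \<epsilon>) * (s + 2 * \<epsilon>) powr (\<mu> - 2)
    + 20 * (s + 2 * \<epsilon>) powr \<mu>"

lemma \<alpha>_eq: "\<alpha> = 2 * \<mu> + 1"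
  using \<mu>_quadratic by (simp add: \<alpha>_def algebra_simps power2_eq_square)

lemma \<beta>_eq: "\<beta> = - 12 * \<mu> - 2"
  using \<mu>_quadratic by (simp add: \<beta>_def algebra_simps power2_eq_square)

lemma \<alpha>_\<beta>_bounds: "0 < \<alpha>" "\<alpha> < 0.42" "0 < \<beta>" "\<beta> < 1.6"
  using \<mu>_bounds by (simp_all add: \<alpha>_eq \<beta>_eq)

text \<open>
  The scaled variables are \<open>e = \<epsilon> / \<tau>\<close> and \<open>X = x\<^sup>2 / \<tau>\<^sup>2\<close>; then \<open>t = \<tau> (1 - 2 e)\<close>. Up to positive
  factors, \<open>neck_laplacian_pos\<close> is the sign of the Laplacian of the barrier, and
  \<open>neck_normal_derivative_pos\<close> that of its normal derivative.
\<close>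

definition neck_range :: "real \<Rightarrow> real \<Rightarrow> real \<Rightarrow> bool" where
  "neck_range \<tau> e X \<longleftrightarrow> 0 < \<tau> \<and> \<tau> \<le> 1/4 \<and> 0 \<le> e \<and> e \<le> 1/2 \<and> 0 \<le> X \<and> X \<le> 1"

lemma \<kappa>_bounds:
  assumes "neck_range \<tau> e X"
  shows "0 < \<kappa> \<tau> e" "\<kappa> \<tau> e \<le> 7"
proof -
  have range: "0 < \<tau>" "\<tau> \<le> 1/4" "0 \<le> e" "e \<le> 1/2" using assms by (auto simp: neck_range_def)
  have "0 \<le> \<beta> * e" using \<alpha>_\<beta>_bounds range by simp
  then show "0 < \<kappa> \<tau> e" using \<alpha>_\<beta>_bounds range unfolding \<kappa>_def by linarith
  have "\<beta> * e \<le> 1.6 * (1/2)" using \<alpha>_\<beta>_bounds range by (intro mult_mono) auto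
  then show "\<kappa> \<tau> e \<le> 7" using \<alpha>_\<beta>_bounds range unfolding \<kappa>_def by simp
qed

lemma \<kappa>'_lower_bound:
  assumes "neck_range \<tau> e X"
  shows "- 4 \<le> X * \<kappa>' \<tau> e"
proof -
  have range: "0 < \<tau>" "\<tau> \<le> 1/4" "0 \<le> e" "e \<le> 1/2" "0 \<le> X" "X \<le> 1"
    using assms by (auto simp: neck_range_def)
  have "\<alpha> * (1 - \<mu>) \<le> 0.42 * 1.3" using \<alpha>_\<beta>_bounds \<mu>_bounds by (intro mult_mono) auto
  moreover have "\<beta> * (2 - \<mu>) * e \<le> 1.6 * 2.3 * (1/2)"
    using \<alpha>_\<beta>_bounds \<mu>_bounds range by (intro mult_mono) auto
  moreover have "(- \<mu>) * \<tau> \<le> 0.3 * (1/4)" using \<mu>_bounds range by (intro mult_mono) auto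
  ultimately have "- \<kappa>' \<tau> e \<le> 4" by (simp add: \<kappa>'_def algebra_simps)
  then have "X * (- \<kappa>' \<tau> e) \<le> X * 4" using range(5) by (rule mult_left_mono)
  then show ?thesis using range(6) by simp
qed

lemma \<kappa>''_nonneg:
  assumes "0 \<le> \<tau>" "0 \<le> e"
  shows "0 \<le> \<kappa>'' \<tau> e"
proof -
  have "0 \<le> (\<mu> - 1) * (\<mu> - 2)" "0 \<le> (\<mu> - 2) * (\<mu> - 3)" "0 \<le> \<mu> * (\<mu> - 1)"
    using \<mu>_bounds by (auto intro!: mult_nonpos_nonpos)
  then show ?thesis
    unfolding \<kappa>''_def mult.assoc[of \<alpha>] mult.assoc[of \<beta>] mult.assoc[of 20]
    using \<alpha>_\<beta>_bounds assms by simp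
qed

lemma neck_laplacian_pos:
  assumes "neck_range \<tau> e X"
  shows "0 < 2 * \<kappa> \<tau> e + 8 * (\<mu> + X * \<tau> * \<kappa>' \<tau> e)
    + 4 * (1 - 2 * e) * (\<mu> * (\<mu> - 1) + X * \<tau> * \<kappa>'' \<tau> e)"
proof -
  have leading: "2 * (\<alpha> + \<beta> * e) + 8 * \<mu> + 4 * (1 - 2 * e) * (\<mu> * (\<mu> - 1)) = 0"
    by (simp add: \<alpha>_def \<beta>_def algebra_simps)
  have "\<tau> * (- 4) \<le> \<tau> * (X * \<kappa>' \<tau> e)"
    using \<kappa>'_lower_bound[OF assms] assms by (intro mult_left_mono) (auto simp: neck_range_def)
  moreover have "0 \<le> 4 * (1 - 2 * e) * (X * \<tau> * \<kappa>'' \<tau> e)"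
    using \<kappa>''_nonneg assms by (simp add: neck_range_def)
  moreover have "0 < \<tau>" using assms by (simp add: neck_range_def)
  ultimately have "0 < 40 * \<tau> + 8 * (\<tau> * (X * \<kappa>' \<tau> e)) + 4 * (1 - 2 * e) * (X * \<tau> * \<kappa>'' \<tau> e)"
    by linarith
  also have "\<dots> = 2 * \<kappa> \<tau> e + 8 * (\<mu> + X * \<tau> * \<kappa>' \<tau> e)
      + 4 * (1 - 2 * e) * (\<mu> * (\<mu> - 1) + X * \<tau> * \<kappa>'' \<tau> e)"
    using leading by (simp add: \<kappa>_def algebra_simps)
  finally show ?thesis .
qed

lemma neck_normal_derivative_lower_bound:
  assumes "neck_range \<tau> e X"
  shows "- (28 * \<tau>) \<le> 1 + 2 * (1 - 2 * e) * (\<mu> + X * \<tau> * \<kappa>' \<tau> e) - (1 - e) * \<kappa> \<tau> e"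
proof -
  have range: "0 < \<tau>" "0 \<le> e" "e \<le> 1/2" using assms by (auto simp: neck_range_def)
  have leading: "1 + 2 * (1 - 2 * e) * \<mu> - (1 - e) * (\<alpha> + \<beta> * e) = (10 * \<mu> + 3) * e + \<beta> * e\<^sup>2"
    by (simp add: \<alpha>_eq \<beta>_eq algebra_simps power2_eq_square)
  have "0 \<le> (10 * \<mu> + 3) * e + \<beta> * e\<^sup>2" using range(2) \<alpha>_\<beta>_bounds \<mu>_bounds by simp
  moreover have "(2 * (1 - 2 * e) * \<tau>) * (- 4) \<le> (2 * (1 - 2 * e) * \<tau>) * (X * \<kappa>' \<tau> e)"
    using \<kappa>'_lower_bound[OF assms] range by (intro mult_left_mono) auto
  moreover have "0 \<le> e * \<tau>" using range by simp
  ultimately have "- (28 * \<tau>) \<le> ((10 * \<mu> + 3) * e + \<beta> * e\<^sup>2)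
      + (2 * (1 - 2 * e) * \<tau>) * (X * \<kappa>' \<tau> e) - (1 - e) * (20 * \<tau>)"
    by (simp add: algebra_simps)
  also have "\<dots> = 1 + 2 * (1 - 2 * e) * (\<mu> + X * \<tau> * \<kappa>' \<tau> e) - (1 - e) * \<kappa> \<tau> e"
    unfolding leading[symmetric] by (simp add: \<kappa>_def algebra_simps)
  finally show ?thesis .
qed

lemma neck_normal_derivative_pos:
  assumes range: "neck_range \<tau> e X" and "0 < P" "P * \<tau> \<le> 1" and "- (1 - e) \<le> m"
  shows "0 < P + 30 + X * \<tau> * P * \<kappa> \<tau> e + 2 * (1 - 2 * e) * P * (\<mu> + X * \<tau> * \<kappa>' \<tau> e)
    + m * (P * \<kappa> \<tau> e)"
proof -
  let ?A = "\<mu> + X * \<tau> * \<kappa>' \<tau> e"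
  have \<kappa>: "0 < \<kappa> \<tau> e" by (rule \<kappa>_bounds[OF range])
  have "P * (- (28 * \<tau>)) \<le> P * (1 + 2 * (1 - 2 * e) * ?A - (1 - e) * \<kappa> \<tau> e)"
    using assms(2) by (intro mult_left_mono neck_normal_derivative_lower_bound range) auto
  moreover have "0 \<le> X * \<tau> * P * \<kappa> \<tau> e" using range assms(2) \<kappa> by (simp add: neck_range_def)
  moreover have "- (1 - e) * (P * \<kappa> \<tau> e) \<le> m * (P * \<kappa> \<tau> e)"
    using assms(2,4) \<kappa> by (intro mult_right_mono) auto
  ultimately show ?thesis using assms(3) by (simp add: algebra_simps)
qed

lemma has_gradient_laplacian_shifted_powr:
  assumes "0 < s + a"
  shows "has_gradient_laplacian (\<lambda>s. (s + a) powr r) (r * (s + a) powr (r - 1))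
    (r * (r - 1) * (s + a) powr (r - 2)) s"
proof (rule has_gradient_laplacianI)
  have D: "DERIV (\<lambda>s. (s + a) powr r) s :> r * (s + a) powr (r - 1)" if "0 < s + a" for s r :: real
    using that by (auto intro!: derivative_eq_intros)
  have "\<forall>\<^sub>F s in nhds s. s \<in> {- a<..}" using assms by (intro eventually_nhds_in_open) auto
  then show "\<forall>\<^sub>F s in nhds s. GDERIV (\<lambda>s. (s + a) powr r) s :> r * (s + a) powr (r - 1)"
    by eventually_elim (simp add: D)
  show "((\<lambda>s. r * (s + a) powr (r - 1)) has_derivative
      (\<lambda>h. h * (r * (r - 1) * (s + a) powr (r - 2)))) (at s)"
    using DERIV_cmult[OF D[OF assms, of "r - 1"], of r]
    by (simp add: has_field_derivative_def mult_commute_abs mult.assoc)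
qed simp_all

lemma has_gradient_laplacian_neck_F:
  assumes "0 < s + 2 * \<epsilon>"
  defines "\<tau> \<equiv> s + 2 * \<epsilon>"
  shows "has_gradient_laplacian (neck_F \<epsilon>) (\<tau> powr \<mu> * \<mu> / \<tau>) (\<tau> powr \<mu> * (\<mu> * (\<mu> - 1)) / \<tau>\<^sup>2) s"
proof -
  have "0 < \<tau>" using assms by simp
  then show ?thesis
    unfolding neck_F_def[abs_def] \<tau>_def
    by (intro has_gradient_laplacian_eq_rhs[OF has_gradient_laplacian_add[OF
            has_gradient_laplacian_shifted_powr has_gradient_laplacian_const]])
      (simp_all add: powr_diff)
qed

lemma has_gradient_laplacian_neck_K:
  assumes "0 < s + 2 * \<epsilon>"
  defines "\<tau> \<equiv> s + 2 * \<epsilon>"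
  shows "has_gradient_laplacian (neck_K \<epsilon>)
    (\<tau> powr \<mu> * \<kappa>' \<tau> (\<epsilon> / \<tau>) / \<tau>\<^sup>2) (\<tau> powr \<mu> * \<kappa>'' \<tau> (\<epsilon> / \<tau>) / \<tau> ^ 3) s"
proof -
  have \<tau>: "0 < \<tau>" using assms by simp
  note D = has_gradient_laplacian_cmult[OF has_gradient_laplacian_shifted_powr[OF assms(1)],
      folded \<tau>_def]
  have powr: "\<tau> powr (\<mu> - 1) = \<tau> powr \<mu> / \<tau>" "\<tau> powr (\<mu> - 2) = \<tau> powr \<mu> / \<tau>\<^sup>2"
    "\<tau> powr (\<mu> - 3) = \<tau> powr \<mu> / \<tau> ^ 3" "\<tau> powr (\<mu> - 4) = \<tau> powr \<mu> / \<tau> ^ 4"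
    using \<tau> by (simp_all add: powr_diff)
  show ?thesis
    unfolding neck_K_def[abs_def]
    by (rule has_gradient_laplacian_eq_rhs[OF has_gradient_laplacian_add[OF
            has_gradient_laplacian_add[OF D[of \<alpha> "\<mu> - 1"] D[of "\<beta> * \<epsilon>" "\<mu> - 2"]] D[of 20 \<mu>]]])
      (use \<tau> in \<open>simp_all add: powr \<kappa>'_def \<kappa>''_def field_simps eval_nat_numeral\<close>)
qed

definition neck_barrier :: "real \<Rightarrow> real^3 \<Rightarrow> real" where
  "neck_barrier \<epsilon> p =
     p $ 2 * (neck_F \<epsilon> (axis_sqdist p) + (p $ 1)\<^sup>2 * neck_K \<epsilon> (axis_sqdist p))"

definition neck :: "(real^3) set" where
  "neck = {p. 0 \<le> p $ 2 \<and> axis_sqdist p \<le> 1/8 \<and> \<bar>p $ 1\<bar> \<le> 1}"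

lemma compact_neck: "compact neck"
proof -
  have "closed neck"
    unfolding neck_def axis_sqdist_def
    by (intro closed_Collect_conj closed_Collect_le continuous_intros)
  moreover have "norm p \<le> 2" if "p \<in> neck" for p
  proof (rule power2_le_imp_le)
    have "(p $ 1)\<^sup>2 \<le> 1" using that by (simp add: neck_def abs_square_le_1)
    then show "(norm p)\<^sup>2 \<le> 2\<^sup>2" using that by (simp add: norm_eq_axis_sqdist neck_def)
  qed simp
  then have "bounded neck" by (rule boundedI)
  ultimately show ?thesis by (simp add: compact_eq_bounded_closed)
qed

locale neck_point =
  fixes \<epsilon> :: real and p :: "real^3"
  assumes eps_pos: "0 < \<epsilon>" and eps_less: "\<epsilon> < 1/16"
    and in_neck: "p \<in> neck" and in_closure: "p \<in> closure (exterior \<epsilon>)"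
begin

definition \<tau> :: real where
  "\<tau> = axis_sqdist p + 2 * \<epsilon>"

definition P :: real where
  "P = \<tau> powr \<mu>"

definition e :: real where
  "e = \<epsilon> / \<tau>"

definition X :: real where
  "X = (p $ 1)\<^sup>2 / \<tau>\<^sup>2"

lemma \<tau>_pos: "0 < \<tau>"
  using eps_pos by (simp add: \<tau>_def add_nonneg_pos)

lemma P_pos: "0 < P"
  using \<tau>_pos by (simp add: P_def)

lemma axis_sqdist_eq: "axis_sqdist p = \<tau> * (1 - 2 * e)"
  using \<tau>_pos by (simp add: e_def right_diff_distrib) (simp add: \<tau>_def)

lemma abscissa_sq_eq: "(p $ 1)\<^sup>2 = X * \<tau>\<^sup>2"
  using \<tau>_pos by (simp add: X_def)

lemma abscissa_le: "\<bar>p $ 1\<bar> \<le> \<epsilon> / 2 + axis_sqdist p"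
  using in_neck by (intro gap_half_width eps_pos in_closure) (auto simp: neck_def)

lemma abscissa_less_1: "\<bar>p $ 1\<bar> < 1"
  using abscissa_le in_neck eps_less by (simp add: neck_def)

lemma scaled_range: "neck_range \<tau> e X"
proof -
  have "\<bar>p $ 1\<bar> \<le> \<bar>\<tau>\<bar>" using abscissa_le eps_pos \<tau>_pos by (simp add: \<tau>_def)
  then have "X \<le> 1" using \<tau>_pos unfolding X_def abs_le_square_iff by simp
  moreover have "e \<le> 1/2" using \<tau>_pos by (simp add: e_def pos_divide_le_eq) (simp add: \<tau>_def)
  moreover have "\<tau> \<le> 1/4" using in_neck eps_less by (simp add: \<tau>_def neck_def)
  ultimately show ?thesis using \<tau>_pos eps_pos by (simp add: neck_range_def e_def X_def)
qed

lemma P_mult_\<tau>_le_1: "P * \<tau> \<le> 1"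
proof -
  have "P * \<tau> = \<tau> powr (\<mu> + 1)" using \<tau>_pos by (simp add: P_def powr_add)
  also have "\<dots> \<le> 1 powr (\<mu> + 1)"
    using scaled_range \<mu>_bounds by (intro powr_mono2) (auto simp: neck_range_def)
  finally show ?thesis by simp
qed

lemma neck_F_eq: "neck_F \<epsilon> (axis_sqdist p) = P + 30"
  by (simp add: neck_F_def P_def \<tau>_def)

lemma neck_K_eq: "neck_K \<epsilon> (axis_sqdist p) = P * \<kappa> \<tau> e / \<tau>"
  using \<tau>_pos unfolding neck_K_def \<kappa>_def \<tau>_def[symmetric]
  by (simp add: P_def e_def powr_diff field_simps power2_eq_square)

lemma has_gradient_laplacian_neck_barrier:
  "has_gradient_laplacian (neck_barrier \<epsilon>)
    ((P + 30 + X * \<tau> * P * \<kappa> \<tau> e) *\<^sub>R axis 2 1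
      + p $ 2 *\<^sub>R ((2 * P / \<tau> * (\<mu> + X * \<tau> * \<kappa>' \<tau> e)) *\<^sub>R (p $ 2 *\<^sub>R axis 2 1 + p $ 3 *\<^sub>R axis 3 1)
        + (2 * p $ 1 * P / \<tau> * \<kappa> \<tau> e) *\<^sub>R axis 1 1))
    (p $ 2 * (P / \<tau> * (2 * \<kappa> \<tau> e + 8 * (\<mu> + X * \<tau> * \<kappa>' \<tau> e)
      + 4 * (1 - 2 * e) * (\<mu> * (\<mu> - 1) + X * \<tau> * \<kappa>'' \<tau> e)))) p"
proof -
  let ?t = "axis_sqdist p"
  have F: "has_gradient_laplacian (neck_F \<epsilon>) (P * \<mu> / \<tau>) (P * (\<mu> * (\<mu> - 1)) / \<tau>\<^sup>2) ?t"
    using has_gradient_laplacian_neck_F[of ?t \<epsilon>] \<tau>_pos by (simp add: \<tau>_def P_def)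
  have K: "has_gradient_laplacian (neck_K \<epsilon>) (P * \<kappa>' \<tau> e / \<tau>\<^sup>2) (P * \<kappa>'' \<tau> e / \<tau> ^ 3) ?t"
    using has_gradient_laplacian_neck_K[of ?t \<epsilon>] \<tau>_pos by (simp add: \<tau>_def P_def e_def)
  have K0: "(p $ 1)\<^sup>2 * (P * \<kappa> \<tau> e / \<tau>) = X * \<tau> * P * \<kappa> \<tau> e"
    using \<tau>_pos unfolding abscissa_sq_eq by (simp add: field_simps power2_eq_square)
  have first: "P * \<mu> / \<tau> + (p $ 1)\<^sup>2 * (P * \<kappa>' \<tau> e / \<tau>\<^sup>2) = P / \<tau> * (\<mu> + X * \<tau> * \<kappa>' \<tau> e)"
    using \<tau>_pos unfolding abscissa_sq_eq by (simp add: field_simps)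
  have second: "P * (\<mu> * (\<mu> - 1)) / \<tau>\<^sup>2 + (p $ 1)\<^sup>2 * (P * \<kappa>'' \<tau> e / \<tau> ^ 3)
      = P / \<tau>\<^sup>2 * (\<mu> * (\<mu> - 1) + X * \<tau> * \<kappa>'' \<tau> e)"
    using \<tau>_pos unfolding abscissa_sq_eq
    by (simp add: field_simps power2_eq_square power3_eq_cube)
  have laplacian: "2 * (P * \<kappa> \<tau> e / \<tau>) + 8 * (P / \<tau> * a) + 4 * ?t * (P / \<tau>\<^sup>2 * b)
      = P / \<tau> * (2 * \<kappa> \<tau> e + 8 * a + 4 * (1 - 2 * e) * b)" for a b
    using \<tau>_pos by (simp add: axis_sqdist_eq field_simps power2_eq_square)
  from has_gradient_laplacian_y_times_axial[OF F K,
      unfolded neck_F_eq neck_K_eq K0 first second laplacian]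
  show ?thesis
    unfolding neck_barrier_def[abs_def]
    by (rule has_gradient_laplacian_eq_rhs) (simp_all add: ac_simps)
qed

lemma neck_barrier_subharmonic:
  assumes "0 < p $ 2"
  shows "\<exists>g L. has_gradient_laplacian (neck_barrier \<epsilon>) g L p \<and> 0 < L"
  by (intro exI conjI, rule has_gradient_laplacian_neck_barrier)
    (intro mult_pos_pos divide_pos_pos neck_laplacian_pos assms P_pos \<tau>_pos scaled_range)

lemma neck_barrier_outflow:
  assumes "0 < p $ 2" and c: "c \<in> {center1 \<epsilon>, center2 \<epsilon>}" "p \<in> sphere c 1"
  shows "\<exists>g. GDERIV (neck_barrier \<epsilon>) p :> g \<and> 0 < (p - c) \<bullet> g"
proof (intro exI conjI)
  let ?A = "\<mu> + X * \<tau> * \<kappa>' \<tau> e" and ?m = "2 * p $ 1 * (p $ 1 - c $ 1) / \<tau>"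
  let ?g = "(P + 30 + X * \<tau> * P * \<kappa> \<tau> e) *\<^sub>R axis 2 1
      + p $ 2 *\<^sub>R ((2 * P / \<tau> * ?A) *\<^sub>R (p $ 2 *\<^sub>R axis 2 1 + p $ 3 *\<^sub>R axis 3 1)
        + (2 * p $ 1 * P / \<tau> * \<kappa> \<tau> e) *\<^sub>R axis 1 1)"
  show "GDERIV (neck_barrier \<epsilon>) p :> ?g"
    by (rule has_gradient_laplacian_GDERIV[OF has_gradient_laplacian_neck_barrier])
  have "- (1 - e) * \<tau> = - (axis_sqdist p + \<epsilon>)"
    using \<tau>_pos by (simp add: e_def left_diff_distrib) (simp add: \<tau>_def)
  then have "- (1 - e) \<le> ?m"
    using sphere_abscissa_bound[OF eps_pos c] \<tau>_pos by (simp add: pos_le_divide_eq)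
  from neck_normal_derivative_pos[OF scaled_range P_pos P_mult_\<tau>_le_1 this]
  have "0 < p $ 2 * (P + 30 + X * \<tau> * P * \<kappa> \<tau> e + 2 * (1 - 2 * e) * P * ?A + ?m * (P * \<kappa> \<tau> e))"
    using assms(1) by simp
  also have "2 * (1 - 2 * e) * P * ?A = 2 * P / \<tau> * ?A * axis_sqdist p"
    using \<tau>_pos by (simp add: axis_sqdist_eq)
  also have "p $ 2 * (P + 30 + X * \<tau> * P * \<kappa> \<tau> e + 2 * P / \<tau> * ?A * axis_sqdist p
      + ?m * (P * \<kappa> \<tau> e)) = (p - c) \<bullet> ?g"
    using c(1)
    by (auto simp: inner_add_right inner_axis axis_sqdist_def power2_eq_square algebra_simps)
  finally show "0 < (p - c) \<bullet> ?g" .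
qed

lemma neck_barrier_le_on_lateral_boundary:
  assumes "axis_sqdist p = 1/8"
  shows "neck_barrier \<epsilon> p \<le> 100 * p $ 2"
proof -
  have "P * (1/8) \<le> P * \<tau>"
    using P_pos eps_pos assms by (intro mult_left_mono) (auto simp: \<tau>_def)
  then have "P \<le> 8" using P_mult_\<tau>_le_1 by linarith
  moreover have "X * (P * \<tau>) * \<kappa> \<tau> e \<le> 1 * 1 * 7"
    using P_pos P_mult_\<tau>_le_1 scaled_range \<kappa>_bounds[OF scaled_range]
    by (intro mult_mono) (auto simp: neck_range_def)
  moreover have "(p $ 1)\<^sup>2 * neck_K \<epsilon> (axis_sqdist p) = X * (P * \<tau>) * \<kappa> \<tau> e"
    using \<tau>_pos unfolding abscissa_sq_eq neck_K_eq by (simp add: field_simps power2_eq_square)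
  ultimately have "neck_F \<epsilon> (axis_sqdist p) + (p $ 1)\<^sup>2 * neck_K \<epsilon> (axis_sqdist p) \<le> 100"
    by (simp add: neck_F_eq)
  then have "neck_barrier \<epsilon> p \<le> p $ 2 * 100"
    unfolding neck_barrier_def using in_neck by (intro mult_left_mono) (auto simp: neck_def)
  then show ?thesis by (simp add: mult.commute)
qed

lemma isCont_neck_barrier: "isCont (neck_barrier \<epsilon>) p"
  using has_gradient_laplacian_GDERIV[OF has_gradient_laplacian_neck_barrier]
  unfolding gderiv_def by (rule has_derivative_continuous)

end

section \<open>Lower bounds for the odd part\<close>

context two_ball_solution
begin

lemma y_le_U:
  assumes "p \<in> closure (exterior \<epsilon>)" "0 \<le> p $ 2"
  shows "p $ 2 \<le> U p"
proof (rule field_le_epsilon)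
  fix \<eta> :: real assume \<eta>: "0 < \<eta>"
  obtain R0 where R0: "\<And>q. R0 \<le> norm q \<Longrightarrow> \<bar>U q - q $ 2\<bar> < \<eta> / 2"
    using tendstoD[OF U_tendsto_y, of "\<eta> / 2"] \<eta>
    unfolding eventually_at_infinity by (auto simp: dist_real_def)
  define R where "R = max (max R0 (norm p)) 1"
  have R: "R0 \<le> R" "norm p \<le> R" "1 \<le> R" by (auto simp: R_def)
  define \<delta> where "\<delta> = \<eta> / (2 * R\<^sup>2)"
  have \<delta>: "0 < \<delta>" "\<delta> * R\<^sup>2 = \<eta> / 2" using \<eta> R by (auto simp: \<delta>_def)
  let ?W = "\<lambda>q :: real^3. q $ 2 + \<delta> * axis_sqdist q + - \<eta>"
  let ?E = "cball 0 R \<inter> {q :: real^3. 0 \<le> q $ 2}" and ?\<Omega> = "ball 0 R \<inter> {q :: real^3. 0 < q $ 2}"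
  have "?W p \<le> 1 * U p"
  proof (rule comparison_principle)
    show "compact ?E"
      by (intro compact_Int_closed compact_cball closed_Collect_le continuous_intros)
    show "open ?\<Omega>" by (intro open_Int open_ball open_Collect_less continuous_intros)
    show "continuous_on (?E \<inter> closure (exterior \<epsilon>)) ?W"
      unfolding axis_sqdist_def by (intro continuous_intros)
    show "?W q \<le> 1 * U q" if q: "q \<in> ?E - ?\<Omega>" for q
    proof -
      have "axis_sqdist q \<le> (norm q)\<^sup>2" by (simp add: norm_eq_axis_sqdist)
      also have "\<dots> \<le> R\<^sup>2" using q by (intro power_mono) auto
      finally have "\<delta> * axis_sqdist q \<le> \<delta> * R\<^sup>2" using \<delta>(1) by (intro mult_left_mono) auto
      then have W: "?W q \<le> q $ 2 - \<eta> / 2" using \<delta>(2) by simp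
      consider "q $ 2 = 0" | "norm q = R" using q by force
      then show ?thesis
        using W \<eta> R0[of q] R(1) U_eq_0[of q] by cases linarith+
    qed
    show "\<exists>g L. has_gradient_laplacian ?W g L q \<and> 0 < L" for q
      by (intro exI conjI, rule has_gradient_laplacian_y_plus_axis_sqdist) (use \<delta>(1) in simp)
    show "\<exists>g. GDERIV ?W q :> g \<and> 0 < (q - c) \<bullet> g"
      if "q \<in> ?\<Omega>" "c \<in> {center1 \<epsilon>, center2 \<epsilon>}" for q c
      by (rule y_plus_axis_sqdist_outflow[OF that(2)]) (use that(1) \<delta>(1) in auto)
  qed (use assms R in auto)
  moreover have "0 \<le> \<delta> * axis_sqdist p" using \<delta>(1) by simp
  ultimately show "p $ 2 \<le> U p + \<eta>" by simp
qed

lemma neck_barrier_le_U: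
  assumes "\<epsilon> < 1/16" "p \<in> neck" "p \<in> closure (exterior \<epsilon>)"
  shows "neck_barrier \<epsilon> p \<le> 100 * U p"
proof (rule comparison_principle)
  let ?\<Omega> = "{q :: real^3. 0 < q $ 2 \<and> axis_sqdist q < 1/8 \<and> \<bar>q $ 1\<bar> < 1}"
  have neck_point: "neck_point \<epsilon> q" if "q \<in> neck" "q \<in> closure (exterior \<epsilon>)" for q
    using that eps_pos assms(1) by unfold_locales
  show "compact neck" by (rule compact_neck)
  show "open ?\<Omega>"
    unfolding axis_sqdist_def by (intro open_Collect_conj open_Collect_less continuous_intros)
  show "?\<Omega> \<subseteq> neck" by (auto simp: neck_def)
  show "continuous_on (neck \<inter> closure (exterior \<epsilon>)) (neck_barrier \<epsilon>)"
    by (intro continuous_at_imp_continuous_on ballI neck_point.isCont_neck_barrier neck_point) auto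
  show "neck_barrier \<epsilon> q \<le> 100 * U q" if q: "q \<in> neck - ?\<Omega>" "q \<in> closure (exterior \<epsilon>)" for q
  proof -
    interpret neck_point \<epsilon> q by (rule neck_point) (use q in auto)
    consider (symmetry_plane) "q $ 2 = 0" | (lateral) "axis_sqdist q = 1/8"
      using q(1) abscissa_less_1 by (force simp: neck_def)
    then show ?thesis
    proof cases
      case symmetry_plane
      then show ?thesis by (simp add: neck_barrier_def U_eq_0)
    next
      case lateral
      then have "neck_barrier \<epsilon> q \<le> 100 * q $ 2" by (rule neck_barrier_le_on_lateral_boundary)
      moreover have "q $ 2 \<le> U q" using q by (intro y_le_U) (auto simp: neck_def)
      ultimately show ?thesis by simp
    qed
  qed
  show "\<exists>g L. has_gradient_laplacian (neck_barrier \<epsilon>) g L q \<and> 0 < L"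
    if q: "q \<in> ?\<Omega>" "q \<in> exterior \<epsilon>" for q
    using q closure_subset
    by (intro neck_point.neck_barrier_subharmonic neck_point) (auto simp: neck_def)
  show "\<exists>g. GDERIV (neck_barrier \<epsilon>) q :> g \<and> 0 < (q - c) \<bullet> g"
    if "q \<in> ?\<Omega>" and c: "c \<in> {center1 \<epsilon>, center2 \<epsilon>}" "q \<in> sphere c 1" for q c
    using that sphere_subset_closure_exterior[OF eps_pos c(1)]
    by (intro neck_point.neck_barrier_outflow neck_point) (auto simp: neck_def)
qed (use assms in auto)

lemma U_axis_lower_bound:
  assumes "\<epsilon> < 1/16" "\<bar>x\<bar> < \<epsilon> / 2" "0 < h" "h \<le> \<epsilon>"
  shows "(3 * \<epsilon>) powr \<mu> / 100 * h \<le> U (vector [x, h, 0])"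
proof -
  let ?p = "vector [x, h, 0] :: real^3"
  have t: "axis_sqdist ?p = h\<^sup>2" by (simp add: axis_sqdist_def)
  have "h * h \<le> \<epsilon> * 1" using assms by (intro mult_mono) auto
  then have h2: "h\<^sup>2 \<le> \<epsilon>" by (simp add: power2_eq_square)
  then have p: "?p \<in> neck" using assms by (simp add: neck_def t)
  have "1 \<le> (1 + \<epsilon> / 2 - \<bar>x\<bar>)\<^sup>2" using assms(2) by (intro one_le_power) simp
  then have p': "?p \<in> closure (exterior \<epsilon>)"
    by (simp add: mem_exterior_iff[OF eps_pos] t add_increasing2)
  have "(3 * \<epsilon>) powr \<mu> \<le> (h\<^sup>2 + 2 * \<epsilon>) powr \<mu>"
    using h2 eps_pos \<mu>_bounds by (intro powr_mono2') (auto intro: add_nonneg_pos)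
  moreover have "0 \<le> x\<^sup>2 * neck_K \<epsilon> (h\<^sup>2)"
    using \<alpha>_\<beta>_bounds eps_pos by (simp add: neck_K_def)
  ultimately have "h * (3 * \<epsilon>) powr \<mu> \<le> neck_barrier \<epsilon> ?p"
    using assms(3) by (simp add: neck_barrier_def t neck_F_def)
  with neck_barrier_le_U[OF assms(1) p p'] show ?thesis by (simp add: mult.commute)
qed

lemma norm_grad_lower_bound:
  assumes "\<epsilon> < 1/16" "\<bar>x\<bar> < \<epsilon> / 2"
  shows "(3 * \<epsilon>) powr \<mu> / 100 \<le> norm (grad u (vector [x, 0, 0]))"
proof -
  let ?p = "vector [x, 0, 0] :: real^3" and ?b = "axis 2 1 :: real^3"
  define k g where "k = (3 * \<epsilon>) powr \<mu> / 100" and "g = grad u ?p \<bullet> ?b"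
  have "1 < (1 + \<epsilon> / 2 - \<bar>x\<bar>)\<^sup>2" using assms(2) by (intro one_less_power) auto
  then have "?p \<in> exterior \<epsilon>" by (simp add: mem_exterior_iff[OF eps_pos] axis_sqdist_def)
  from has_gradient_laplacian_GDERIV[OF has_gradient_laplacian_U[OF this]]
  have "GDERIV U ?p :> (1/2) *\<^sub>R (grad u ?p - yreflect (grad u ?p))" by (simp add: yreflect_fixes)
  then have "DERIV (\<lambda>h. U (?p + h *\<^sub>R ?b)) 0 :> ?b \<bullet> ((1/2) *\<^sub>R (grad u ?p - yreflect (grad u ?p)))"
    by (intro GDERIV_along_line) simp
  moreover have "?b \<bullet> ((1/2) *\<^sub>R (grad u ?p - yreflect (grad u ?p))) = g"
    by (simp add: inner_axis' g_def inner_axis)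
  moreover have "?p + h *\<^sub>R ?b = vector [x, h, 0]" for h
    by (simp add: vec_eq_iff forall_3 axis_def)
  ultimately have D: "DERIV (\<lambda>h. k * h - U (vector [x, h, 0])) 0 :> k - g"
    by (auto intro!: derivative_eq_intros)
  have "k \<le> g"
  proof (rule ccontr)
    assume "\<not> k \<le> g"
    with DERIV_pos_inc_right[OF D] obtain d where d: "0 < d"
      "\<And>h. 0 < h \<Longrightarrow> h < d \<Longrightarrow> - U ?p < k * h - U (vector [x, h, 0])" by auto
    define h where "h = min d \<epsilon> / 2"
    have "0 < h" "h < d" "h \<le> \<epsilon>" using d(1) eps_pos by (auto simp: h_def min_def)
    then show False
      using d(2)[of h] U_axis_lower_bound[OF assms, of h] by (simp add: k_def U_eq_0)
  qed
  also have "g \<le> norm (grad u ?p)"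
    using norm_cauchy_schwarz[of "grad u ?p" ?b] by (simp add: g_def)
  finally show ?thesis by (simp add: k_def)
qed

end

theorem theorem2p2:
  shows "\<exists>C>0. \<exists>\<epsilon>0>0. \<forall>\<epsilon>::real. 0 < \<epsilon> \<and> \<epsilon> < \<epsilon>0 \<longrightarrow>
           (\<forall>u. insulated_solution \<epsilon> (\<lambda>p. p $ 2) u \<longrightarrow>
             (\<forall>x::real. \<bar>x\<bar> < \<epsilon> / 2 \<longrightarrow>
               norm (grad u (vector [x, 0, 0])) \<ge> C * (1 / \<epsilon> powr ((2 - sqrt 2) / 2))))"
proof (intro exI conjI allI impI)
  show "0 < 3 powr \<mu> / 100" "(0::real) < 1/16" by simp_all
  fix \<epsilon> x :: real and u :: "real^3 \<Rightarrow> real"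
  assume \<epsilon>: "0 < \<epsilon> \<and> \<epsilon> < 1/16" and u: "insulated_solution \<epsilon> (\<lambda>p. p $ 2) u" and x: "\<bar>x\<bar> < \<epsilon> / 2"
  interpret two_ball_solution \<epsilon> u by unfold_locales (use \<epsilon> u in auto)
  have "3 powr \<mu> / 100 * (1 / \<epsilon> powr ((2 - sqrt 2) / 2)) = (3 * \<epsilon>) powr \<mu> / 100"
    using \<epsilon> by (simp add: powr_mult \<mu>_def powr_minus_divide[symmetric] diff_divide_distrib)
  also have "\<dots> \<le> norm (grad u (vector [x, 0, 0]))"
    using \<epsilon> x by (intro norm_grad_lower_bound) auto
  finally show "3 powr \<mu> / 100 * (1 / \<epsilon> powr ((2 - sqrt 2) / 2))
      \<le> norm (grad u (vector [x, 0, 0]))" .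
qed

end
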